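(* Let $d_1,d_2\in\mathbb Z_+$, $\Gamma=(\{0,\ldots,d_1\}\times\{0,\ldots,d_2\})\setminus\{(0,0)\}$, $\Gamma_2=\{0,\ldots,d_1\}\times[d_2]$, $\Gamma_1^c=\{0\}\times[d_2]$, $\tau\in(1,2]$. Let $p_0>2$ be an even integer, let $\delta\in(0,1)$ be the constant specified in the context, and let $\chi_1,u_1,\chi_2,u_2,\alpha>0$ satisfy $$\frac1{10^6|\Gamma|p_0}>\chi_1>4(|\Gamma|+1)u_1>\frac{10^3}{\delta}(|\Gamma|+1)^3\chi_2>\frac{10^3}{\delta}(|\Gamma|+1)^3u_2>\frac{10^6}{\delta^2}(|\Gamma|+1)^6\alpha.$$ There is a constant $C_\Gamma>0$ depending only on $\Gamma$ such that, if $\varrho\in(0,1)$ satisfies $1/\varrho>100(|\Gamma|+1+C_\Gamma)$, then the following holds. For $M_1,N\in\mathbb D_\tau$, $m_1\in\mathbb Z$ and $\theta\in\Sigma^{\Gamma_1^c}_{\le\mathrm l(M_1^{u_2})}$ let $$A^{m_1}_{M_1,N}(\theta):=\Big\{\xi\in\mathbb T^\Gamma:\ 1-\Pi_{M_1,N}(\xi)\ne0\ \text{ and }\ \prod_{\gamma_2\in[d_2]}\eta\Big(2^{\operatorname{Log}(N^{\gamma_2}/M_1^{\chi_2})}\big(\{\xi_{\gamma_2}(m_1)\}-\theta_{\gamma_2}\big)\Big)\ne0\Big\},$$ $$A^{m_1}_{M_1}(\theta):=\bigcup_{N\in\mathbb D_\tau:\,N\ge M_1^{1/\varrho}}A^{m_1}_{M_1,N}(\theta),\qquad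 A^{m_1}_{M_1}:=\bigcup_{\theta\in\Sigma^{\Gamma_1^c}_{\le\mathrm l(M_1^{u_2})}}A^{m_1}_{M_1}(\theta),$$ where $\xi_{\gamma_2}(m_1):=\sum_{\gamma_1=0}^{d_1}\xi_{(\gamma_1,\gamma_2)}m_1^{\gamma_1}$. Then for every $M_1\in\mathbb D_\tau$ the estimate $$\sum_{m_1\in\mathbb Z}\chi_{M_1}(m_1)\,\mathbf 1_{A^{m_1}_{M_1}(\theta)}(\xi)\lesssim M_1^{-u_1/(2(|\Gamma|+1)^2)}$$ holds uniformly in $\theta\in\Sigma^{\Gamma_1^c}_{\le\mathrm l(M_1^{u_2})}$ and $\xi\in\mathbb T^\Gamma$. Consequently, $$\sum_{m_1\in\mathbb Z}\chi_{M_1}(m_1)\,\mathbf 1_{A^{m_1}_{M_1}}(\xi)\lesssim M_1^{-4\alpha},\qquad\xi\in\mathbb T^\Gamma.$$ The implicit constants do not depend on $M_1$, $\theta$, $\xi$ (they may depend on $\Gamma,\tau$ and the fixed parameters $p_0,\chi_1,u_1,\chi_2,u_2,\alpha,\varrho$).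
   Context: $[n]=\{1,\dots,n\}$, $\mathbb T=\mathbb R/\mathbb Z$ identified with $[-1/2,1/2)$; differences of elements of $\mathbb T$ are taken mod 1 with representative in $[-1/2,1/2)$. $\{x\}$ is the fractional part. $e(z)=e^{2\pi iz}$. $\mathbb D_\tau=\{\tau^n:n=0,1,2,\ldots\}$. $\operatorname{Log}x:=\lfloor\log_2x\rfloor$ and $\mathrm l(K):=\operatorname{Log}K$. $\chi_{M_1}(x):=|(M_1,\tau M_1]\cap\mathbb Z|^{-1}\mathbf 1_{(M_1,\tau M_1]}(x)$ (so the sums above are averages over integers $m_1\in(M_1,\tau M_1]$; read as $0$ if there are none). $\eta:\mathbb R\to[0,1]$ is a fixed smooth even function with $\mathbf 1_{[-1/4,1/4]}\le\eta\le\mathbf 1_{[-1/2,1/2]}$. For a finite nonempty index set $\Lambda$ and $l\in\mathbb N$, $\Sigma^\Lambda_{\le l}:=\{a/q\in(\mathbb Q\cap\mathbb T)^\Lambda:1\le q\le2^l,\ \gcd(\{a_\gamma\}_{\gamma\in\Lambda}\cup\{q\})=1\}$. The set $\Gamma_1^c=\{0\}\times[d_2]$ is identified with $[d_2]$, so $\theta=(\theta_{\gamma_2})_{\gamma_2\in[d_2]}$. Major-arc projection: for $\xi\in\mathbb T^\Gamma$, $$\Pi_{M_1,N}(\xi):=\sum_{\omega\in\Sigma^{\Gamma_2}_{\le\mathrm l(M_1^{u_1})}}\ \prod_{\gamma\in\Gamma_2}\eta\Big(2^{\operatorname{Log}(M_1^{\gamma_1}N^{\gamma_2}/M_1^{\chi_1})}(\xi_\gamma-\omega_\gamma)\Big).$$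 The constant $\delta$: $\delta:=\min(\delta_{\rm Weyl},\delta_{\rm Gauss},\delta_{\rm vdC})$, a fixed constant depending only on $\Gamma$, where: (1) $\delta_{\rm Weyl}:=\min\big(\frac1{2\tau(d_2)},\frac1{4k_1k_2}\big)$, $k_i:=d_i(d_i+1)$, and $\tau(d)\in\mathbb Z_+$ is a fixed exponent for which Weyl's inequality $|\sum_{m=1}^Me(c_dm^d+\cdots+c_1m)|\le CM\log(2M)\big(\frac1q+\frac1M+\frac q{M^j}\big)^{1/\tau(d)}$ holds whenever $j\in[d]$, $(a,q)=1$, $1\le q\le M^j$, $|c_j-a/q|\le q^{-2}$. (2) $\delta_{\rm Gauss}\in(0,1)$ is a fixed exponent such that, for every nonempty $\Lambda\subseteq\Gamma$, $\big|q^{-2}\sum_{r_1,r_2=1}^qe(\sum_{\gamma\in\Lambda}r_1^{\gamma_1}r_2^{\gamma_2}a_\gamma/q)\big|\lesssim q^{-\delta_{\rm Gauss}}$ whenever $\gcd(\{a_\gamma\}_{\gamma\in\Lambda}\cup\{q\})=1$, and $\frac1{M}\sum_{m_1=1}^{M}\big|q^{-1}\sum_{r_2=1}^qe(\sum_{\gamma\in\Gamma_2}m_1^{\gamma_1}r_2^{\gamma_2}a_\gamma/q)\big|\lesssim q^{-\delta_{\rm Gauss}}$ whenever $\gcd(\{a_\gamma\}_{\gamma\in\Gamma_2}\cup\{q\})=1$ and $q\le M^{10|\Gamma|}$, together with the analogous estimate with the roles of the two variables exchanged. (3) $\delta_{\rm vdC}\in(0,1)$ is a fixed exponent such that for all nonempty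 $\Lambda\subseteq\Gamma$ and $M_1,M_2>0$, $\big|\frac1{(\tau-1)^2}\int_{[1,\tau]^2}e(\sum_{\gamma\in\Lambda}\xi_\gamma(M_1t_1)^{\gamma_1}(M_2t_2)^{\gamma_2})dt\big|\lesssim(\max_{\gamma\in\Lambda}M_1^{\gamma_1}M_2^{\gamma_2}|\xi_\gamma|)^{-\delta_{\rm vdC}}$. *)

theory Defs
  imports "HOL-Analysis.Analysis"
begin

section \<open>The torus and elementary notation\<close>

definition e :: "real \<Rightarrow> complex" where
  "e x = exp (2 * of_real pi * \<i> * of_real x)"

text \<open>\<open>\<real>/\<int>\<close> is represented by \<open>[-1/2, 1/2)\<close>; vectors over an index set are extensional
  functions (\<open>undefined\<close> off the index set), so that sets of such vectors and sums over them
  are the intended ones.\<close>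

definition torus :: "'i set \<Rightarrow> ('i \<Rightarrow> real) set" where
  "torus L = (L \<rightarrow>\<^sub>E {-1/2..<1/2})"

definition torus_rep :: "real \<Rightarrow> real" where
  "torus_rep x = x - of_int \<lfloor>x + 1/2\<rfloor>"

definition torus_diff :: "real \<Rightarrow> real \<Rightarrow> real" where
  "torus_diff x y = torus_rep (x - y)"

definition geom :: "real \<Rightarrow> real set" where
  "geom \<tau> = range (\<lambda>n::nat. \<tau> ^ n)"

definition Log :: "real \<Rightarrow> int" where
  "Log x = \<lfloor>log 2 x\<rfloor>"

text \<open>Levels are natural numbers; \<open>lvl\<close> is only used for arguments \<open>K \<ge> 1\<close>, where \<open>Log K \<ge> 0\<close>.\<close>

definition lvl :: "real \<Rightarrow> nat" where
  "lvl K = nat (Log K)"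

definition avg_weight :: "real \<Rightarrow> real \<Rightarrow> int \<Rightarrow> real" where
  "avg_weight \<tau> M m =
     indicator {M<..\<tau> * M} (of_int m) / real (card {k::int. M < of_int k \<and> of_int k \<le> \<tau> * M})"

definition cutoff :: "(real \<Rightarrow> real) \<Rightarrow> bool" where
  "cutoff \<eta> \<longleftrightarrow>
     (\<forall>k x. (deriv ^^ k) \<eta> differentiable (at x)) \<and>
     (\<forall>x. \<eta> (- x) = \<eta> x) \<and>
     (\<forall>x. 0 \<le> \<eta> x \<and> \<eta> x \<le> 1) \<and>
     (\<forall>x. indicator {-1/4..1/4} x \<le> \<eta> x \<and> \<eta> x \<le> indicator {-1/2..1/2} x)"


section \<open>Index sets and rational points\<close>

definition Idx :: "nat \<Rightarrow> nat \<Rightarrow> (nat \<times> nat) set" where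
  "Idx d1 d2 = ({0..d1} \<times> {0..d2}) - {(0, 0)}"

definition Idx1 :: "nat \<Rightarrow> nat \<Rightarrow> (nat \<times> nat) set" where
  "Idx1 d1 d2 = {1..d1} \<times> {0..d2}"

definition Idx2 :: "nat \<Rightarrow> nat \<Rightarrow> (nat \<times> nat) set" where
  "Idx2 d1 d2 = {0..d1} \<times> {1..d2}"

definition reduced_frac :: "'i set \<Rightarrow> ('i \<Rightarrow> int) \<Rightarrow> nat \<Rightarrow> bool" where
  "reduced_frac L a q \<longleftrightarrow> 1 \<le> q \<and> Gcd (insert (int q) (a ` L)) = 1"

definition Sigma_le :: "'i set \<Rightarrow> nat \<Rightarrow> ('i \<Rightarrow> real) set" where
  "Sigma_le L l =
     {\<omega> \<in> torus L. \<exists>a q. reduced_frac L a q \<and> q \<le> 2 ^ l \<and> (\<forall>\<gamma>\<in>L. \<omega> \<gamma> = of_int (a \<gamma>) / of_nat q)}"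


section \<open>Admissible exponents\<close>

definition weyl_exponent :: "nat \<Rightarrow> nat \<Rightarrow> bool" where
  "weyl_exponent d t \<longleftrightarrow> 1 \<le> t \<and>
     (\<exists>C>0. \<forall>(c :: nat \<Rightarrow> real) (M :: nat) (j :: nat) (a :: int) (q :: nat).
        1 \<le> M \<longrightarrow> j \<in> {1..d} \<longrightarrow> coprime a (int q) \<longrightarrow> 1 \<le> q \<longrightarrow> q \<le> M ^ j \<longrightarrow>
        \<bar>c j - of_int a / of_nat q\<bar> \<le> 1 / of_nat q ^ 2 \<longrightarrow>
        norm (\<Sum>m = 1..M. e (\<Sum>i = 1..d. c i * real m ^ i))
          \<le> C * real M * ln (2 * real M)
              * (1 / real q + 1 / real M + real q / real M ^ j) powr (1 / real t))"

definition gauss_exponent :: "nat \<Rightarrow> nat \<Rightarrow> real \<Rightarrow> bool" where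
  "gauss_exponent d1 d2 \<delta> \<longleftrightarrow> 0 < \<delta> \<and> \<delta> < 1 \<and>
     (\<exists>C>0.
       (\<forall>L a q. L \<subseteq> Idx d1 d2 \<longrightarrow> L \<noteq> {} \<longrightarrow> reduced_frac L a q \<longrightarrow>
          norm ((\<Sum>r1 = 1..q. \<Sum>r2 = 1..q.
                   e (\<Sum>(g1, g2)\<in>L. real r1 ^ g1 * real r2 ^ g2 * of_int (a (g1, g2)) / real q))
                / of_nat q ^ 2)
            \<le> C * real q powr (- \<delta>)) \<and>
       (\<forall>a q M. reduced_frac (Idx2 d1 d2) a q \<longrightarrow> 1 \<le> M \<longrightarrow> q \<le> M ^ (10 * card (Idx d1 d2)) \<longrightarrow>
          (\<Sum>m1 = 1..M. norm ((\<Sum>r2 = 1..q.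
                   e (\<Sum>(g1, g2)\<in>Idx2 d1 d2.
                        real m1 ^ g1 * real r2 ^ g2 * of_int (a (g1, g2)) / real q))
                / of_nat q)) / real M
            \<le> C * real q powr (- \<delta>)) \<and>
       (\<forall>a q M. reduced_frac (Idx1 d1 d2) a q \<longrightarrow> 1 \<le> M \<longrightarrow> q \<le> M ^ (10 * card (Idx d1 d2)) \<longrightarrow>
          (\<Sum>m2 = 1..M. norm ((\<Sum>r1 = 1..q.
                   e (\<Sum>(g1, g2)\<in>Idx1 d1 d2.
                        real r1 ^ g1 * real m2 ^ g2 * of_int (a (g1, g2)) / real q))
                / of_nat q)) / real M
            \<le> C * real q powr (- \<delta>)))"

text \<open>The frequency must not vanish on \<open>L\<close>: in HOL \<open>0 powr (- \<delta>) = 0\<close>, whereas the intended bound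
  is vacuous there.\<close>

definition vdc_exponent :: "nat \<Rightarrow> nat \<Rightarrow> real \<Rightarrow> real \<Rightarrow> bool" where
  "vdc_exponent d1 d2 \<tau> \<delta> \<longleftrightarrow> 0 < \<delta> \<and> \<delta> < 1 \<and>
     (\<exists>C>0. \<forall>L (\<xi> :: nat \<times> nat \<Rightarrow> real) M1 M2.
        L \<subseteq> Idx d1 d2 \<longrightarrow> L \<noteq> {} \<longrightarrow> 0 < M1 \<longrightarrow> 0 < M2 \<longrightarrow> (\<exists>\<gamma>\<in>L. \<xi> \<gamma> \<noteq> 0) \<longrightarrow>
        norm (integral ({1..\<tau>} \<times> {1..\<tau>})
                (\<lambda>(t1, t2). e (\<Sum>(g1, g2)\<in>L. \<xi> (g1, g2) * (M1 * t1) ^ g1 * (M2 * t2) ^ g2))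
              / of_real ((\<tau> - 1) ^ 2))
          \<le> C * (MAX (g1, g2)\<in>L. M1 ^ g1 * M2 ^ g2 * \<bar>\<xi> (g1, g2)\<bar>) powr (- \<delta>))"

definition delta_weyl :: "nat \<Rightarrow> nat \<Rightarrow> nat \<Rightarrow> real" where
  "delta_weyl d1 d2 t =
     min (1 / (2 * real t)) (1 / (4 * real (d1 * (d1 + 1)) * real (d2 * (d2 + 1))))"

definition is_delta :: "nat \<Rightarrow> nat \<Rightarrow> real \<Rightarrow> real \<Rightarrow> bool" where
  "is_delta d1 d2 \<tau> \<delta> \<longleftrightarrow>
     (\<exists>t \<delta>G \<delta>V. weyl_exponent d2 t \<and> gauss_exponent d1 d2 \<delta>G \<and> vdc_exponent d1 d2 \<tau> \<delta>V \<and>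
        \<delta> = min (delta_weyl d1 d2 t) (min \<delta>G \<delta>V))"


section \<open>The major-arc projection and the exceptional sets\<close>

definition major_proj ::
  "nat \<Rightarrow> nat \<Rightarrow> (real \<Rightarrow> real) \<Rightarrow> real \<Rightarrow> real \<Rightarrow> real \<Rightarrow> real \<Rightarrow> (nat \<times> nat \<Rightarrow> real) \<Rightarrow> real" where
  "major_proj d1 d2 \<eta> chi1 u1 M1 N \<xi> =
     (\<Sum>\<omega>\<in>Sigma_le (Idx2 d1 d2) (lvl (M1 powr u1)).
        \<Prod>(g1, g2)\<in>Idx2 d1 d2.
          \<eta> (2 powi Log (M1 ^ g1 * N ^ g2 / M1 powr chi1)
               * torus_diff (\<xi> (g1, g2)) (\<omega> (g1, g2))))"

definition slice :: "nat \<Rightarrow> (nat \<times> nat \<Rightarrow> real) \<Rightarrow> int \<Rightarrow> nat \<Rightarrow> real" where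
  "slice d1 \<xi> m1 g2 = (\<Sum>g1 = 0..d1. \<xi> (g1, g2) * of_int m1 ^ g1)"

definition A_scale ::
  "nat \<Rightarrow> nat \<Rightarrow> (real \<Rightarrow> real) \<Rightarrow> real \<Rightarrow> real \<Rightarrow> real \<Rightarrow> real \<Rightarrow> real \<Rightarrow> int \<Rightarrow>
    (nat \<Rightarrow> real) \<Rightarrow> (nat \<times> nat \<Rightarrow> real) set" where
  "A_scale d1 d2 \<eta> chi1 u1 chi2 M1 N m1 \<theta> =
     {\<xi> \<in> torus (Idx d1 d2).
        1 - major_proj d1 d2 \<eta> chi1 u1 M1 N \<xi> \<noteq> 0 \<and>
        (\<Prod>g2\<in>{1..d2}. \<eta> (2 powi Log (N ^ g2 / M1 powr chi2)
                              * torus_diff (frac (slice d1 \<xi> m1 g2)) (\<theta> g2))) \<noteq> 0}"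

definition A_theta ::
  "nat \<Rightarrow> nat \<Rightarrow> real \<Rightarrow> (real \<Rightarrow> real) \<Rightarrow> real \<Rightarrow> real \<Rightarrow> real \<Rightarrow> real \<Rightarrow> real \<Rightarrow> int \<Rightarrow>
    (nat \<Rightarrow> real) \<Rightarrow> (nat \<times> nat \<Rightarrow> real) set" where
  "A_theta d1 d2 \<tau> \<eta> chi1 u1 chi2 \<rho> M1 m1 \<theta> =
     (\<Union>N\<in>{N \<in> geom \<tau>. N \<ge> M1 powr (1 / \<rho>)}. A_scale d1 d2 \<eta> chi1 u1 chi2 M1 N m1 \<theta>)"

definition A_all ::
  "nat \<Rightarrow> nat \<Rightarrow> real \<Rightarrow> (real \<Rightarrow> real) \<Rightarrow> real \<Rightarrow> real \<Rightarrow> real \<Rightarrow> real \<Rightarrow> real \<Rightarrow> real \<Rightarrow> int \<Rightarrow>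
    (nat \<times> nat \<Rightarrow> real) set" where
  "A_all d1 d2 \<tau> \<eta> chi1 u1 chi2 u2 \<rho> M1 m1 =
     (\<Union>\<theta>\<in>Sigma_le {1..d2} (lvl (M1 powr u2)). A_theta d1 d2 \<tau> \<eta> chi1 u1 chi2 \<rho> M1 m1 \<theta>)"

end

theory Submission
  imports Defs "HOL-Computational_Algebra.Polynomial"
begin

text \<open>
  Write \<open>\<kappa> = u1 / (2 (|\<Gamma>| + 1)\<^sup>2)\<close> and let \<open>S\<close> be the set of those \<open>m\<close> in \<open>(M, \<tau> M]\<close> for which \<open>\<xi>\<close> is
  exceptional. For \<open>m\<close> in \<open>S\<close> there is a scale \<open>N\<close> such that, for every \<open>g\<close> in \<open>{1..d2}\<close>, the polynomial
  \<open>P\<^sub>g(m) = \<Sum>i\<le>d1. \<xi> (i, g) * m ^ i\<close> is within \<open>M powr chi2 / N ^ g\<close> of \<open>\<theta> g\<close> modulo 1, and yet \<open>\<xi>\<close> is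
  not in a major arc at scale \<open>N\<close>. All \<open>m\<close> in \<open>S\<close> may be given the same scale, the least one that
  occurs. The theorem is thus an inverse statement (\<open>dense_forces_major_arc\<close>): if \<open>S\<close> had more than a
  constant times \<open>M powr (1 - \<kappa>)\<close> elements, then \<open>\<xi>\<close> would lie in a major arc and the projection
  would be 1.

  The proof of the inverse statement is elementary; it interpolates each \<open>P\<^sub>g\<close> twice
  (\<open>rational_coefficients\<close>). First, by pigeonhole, \<open>S\<close> contains \<open>d1 + 1\<close> points in an interval of length
  about \<open>M powr \<kappa>\<close>. Lagrange interpolation at these points has the common denominator
  \<open>M powr (\<kappa> d1 (d1 + 1))\<close> at most, up to a constant, so the coefficients of \<open>P\<^sub>g\<close> are close to
  rationals \<open>r\<^sub>g\<close> whose denominator, including that of \<open>\<theta>\<close>, is less than \<open>M powr u1\<close>. The error in this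
  step loses powers of \<open>M\<close>, but \<open>N\<close> is a much larger power of \<open>M\<close>. Hence on \<open>S\<close> the polynomial with
  coefficients \<open>r\<^sub>g\<close> is closer to \<open>\<theta> g\<close> modulo 1 than its denominator permits unless the two agree;
  so they agree, and \<open>P\<^sub>g\<close> differs from that polynomial by at most \<open>M powr chi2 / N ^ g\<close> on \<open>S\<close>.
  Second, \<open>S\<close> also contains \<open>d1 + 1\<close> points at mutual distance \<open>M powr (1 - \<kappa>)\<close>. Interpolating the
  difference at these turns the bound on values into a bound \<open>M powr (\<kappa> d1 + chi2 - i) / N ^ g\<close> on the
  \<open>i\<close>-th coefficient, up to a constant, which puts \<open>\<xi>\<close> into the major arc around \<open>r\<close>
  (\<open>major_proj_eq_1\<close>).

  The second estimate follows from the first by summing over the points \<open>\<theta>\<close>, of which there are at most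
  \<open>3 ^ d2 * M powr (u2 (d2 + 1))\<close>.
\<close>

section \<open>Separated and clustered points of a set of integers\<close>

text \<open>Greedy choice: taking the smallest element and discarding everything at distance less than
  \<open>B\<close> to its right costs at most \<open>B\<close> elements.\<close>

lemma separated_subset:
  fixes S :: "int set"
  assumes "finite S" "0 < B" "d * B < card S"
  shows "\<exists>T\<subseteq>S. card T = Suc d \<and> (\<forall>s\<in>T. \<forall>t\<in>T. s \<noteq> t \<longrightarrow> int B \<le> \<bar>s - t\<bar>)"
  using assms
proof (induction d arbitrary: S)
  case 0
  then obtain x where "x \<in> S" by fastforce
  then show ?case by (intro exI[of _ "{x}"]) auto
next
  case (Suc d)
  define x where "x = Min S"
  define S' where "S' = S - {x..<x + int B}"
  have ne: "S \<noteq> {}" using Suc.prems by auto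
  have x: "x \<in> S" "\<And>y. y \<in> S \<Longrightarrow> x \<le> y" using Suc.prems ne by (auto simp: x_def)
  have "card S - card {x..<x + int B} \<le> card S'"
    unfolding S'_def by (rule diff_card_le_card_Diff) auto
  then have "d * B < card S'" using Suc.prems by simp
  with Suc.IH[of S'] Suc.prems obtain T where
    T: "T \<subseteq> S'" "card T = Suc d" "\<forall>s\<in>T. \<forall>t\<in>T. s \<noteq> t \<longrightarrow> int B \<le> \<bar>s - t\<bar>"
    by (auto simp: S'_def)
  have far: "x + int B \<le> y" if "y \<in> T" for y
    using T(1) that x(2)[of y] by (force simp: S'_def)
  then have "x \<notin> T" using Suc.prems(2) by force
  moreover have "finite T" using T(2) by (simp add: card_ge_0_finite)
  ultimately have "card (insert x T) = Suc (Suc d)" using T(2) by simp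
  moreover have "insert x T \<subseteq> S" using T(1) x(1) by (auto simp: S'_def)
  moreover have "\<forall>s\<in>insert x T. \<forall>t\<in>insert x T. s \<noteq> t \<longrightarrow> int B \<le> \<bar>s - t\<bar>"
    using T(3) far by force
  ultimately show ?case by blast
qed

text \<open>Pigeonhole over the blocks \<open>[j L, (j + 1) L)\<close>: at most \<open>M / L + 2 \<le> 3 M / L\<close> of them meet
  \<open>(M, 2 M]\<close>, so one block contains more than \<open>d\<close> elements.\<close>

lemma clustered_subset:
  fixes S :: "int set" and M :: real and L d :: nat
  assumes "finite S" and S: "\<And>m. m \<in> S \<Longrightarrow> M < of_int m \<and> of_int m \<le> 2 * M"
    and L: "1 \<le> L" "real L \<le> M" and dense: "3 * real d * M / real L < card S"
  shows "\<exists>T\<subseteq>S. card T = Suc d \<and> (\<forall>s\<in>T. \<forall>t\<in>T. \<bar>s - t\<bar> \<le> int L)"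
proof -
  define f where "f = (\<lambda>m. m div int L)"
  have sub: "f ` S \<subseteq> {\<lfloor>M\<rfloor> div int L .. \<lfloor>2 * M\<rfloor> div int L}"
  proof
    fix y assume "y \<in> f ` S"
    then obtain m where m: "m \<in> S" "y = m div int L" by (auto simp: f_def)
    have "\<lfloor>M\<rfloor> \<le> m" "m \<le> \<lfloor>2 * M\<rfloor>" using S[OF m(1)] by linarith+
    then show "y \<in> {\<lfloor>M\<rfloor> div int L .. \<lfloor>2 * M\<rfloor> div int L}"
      using L m by (auto intro: zdiv_mono1)
  qed
  have Lpos: "real L > 0" using L by simp
  have up: "of_int (\<lfloor>2 * M\<rfloor> div int L) \<le> 2 * M / real L"
  proof -
    have "\<lfloor>2 * M\<rfloor> div int L * int L \<le> \<lfloor>2 * M\<rfloor>"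
      using L div_mult_mod_eq[of "\<lfloor>2 * M\<rfloor>" "int L"] pos_mod_sign[of "int L" "\<lfloor>2 * M\<rfloor>"]
      by linarith
    then have "real_of_int (\<lfloor>2 * M\<rfloor> div int L * int L) \<le> 2 * M" by linarith
    then show ?thesis using Lpos by (simp add: field_simps)
  qed
  have lo: "M / real L - 1 < of_int (\<lfloor>M\<rfloor> div int L)"
  proof -
    have "\<lfloor>M\<rfloor> mod int L < int L" using L by simp
    moreover have "\<lfloor>M\<rfloor> = \<lfloor>M\<rfloor> div int L * int L + \<lfloor>M\<rfloor> mod int L" by simp
    ultimately have "\<lfloor>M\<rfloor> \<le> \<lfloor>M\<rfloor> div int L * int L + int L - 1" by linarith
    then have "M < real_of_int (\<lfloor>M\<rfloor> div int L * int L + int L)" by linarith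
    then show ?thesis using Lpos by (simp add: field_simps)
  qed
  have blocks: "real (card (f ` S)) \<le> 3 * M / real L"
  proof -
    have "card (f ` S) \<le> card {\<lfloor>M\<rfloor> div int L .. \<lfloor>2 * M\<rfloor> div int L}"
      by (rule card_mono[OF _ sub]) simp
    also have "real \<dots> = real_of_int (\<lfloor>2 * M\<rfloor> div int L) - of_int (\<lfloor>M\<rfloor> div int L) + 1"
    proof -
      have "\<lfloor>M\<rfloor> div int L \<le> \<lfloor>2 * M\<rfloor> div int L"
        using L by (intro zdiv_mono1) linarith+
      then show ?thesis by (simp add: of_nat_nat)
    qed
    also have "\<dots> \<le> M / real L + 2"
    proof -
      have "2 * M / real L = M / real L + M / real L" by simp
      then show ?thesis using up lo by linarith
    qed
    also have "\<dots> \<le> 3 * M / real L" using L Lpos by (simp add: field_simps)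
    finally show ?thesis by simp
  qed
  have "\<exists>y\<in>f ` S. d < card {x\<in>S. f x = y}"
  proof (rule ccontr)
    assume "\<not> ?thesis"
    then have small: "\<And>y. y \<in> f ` S \<Longrightarrow> card {x\<in>S. f x = y} \<le> d" by force
    have "card S = (\<Sum>y\<in>f ` S. card {x\<in>S. f x = y})"
      using sum.image_gen[OF assms(1), of "\<lambda>_. 1::nat" f] by simp
    also have "\<dots> \<le> (\<Sum>y\<in>f ` S. d)" by (rule sum_mono) (rule small)
    finally have "card S \<le> card (f ` S) * d" by simp
    then have "real (card S) \<le> real (card (f ` S)) * real d" by (metis of_nat_le_iff of_nat_mult)
    also have "\<dots> \<le> 3 * M / real L * real d" using blocks by (rule mult_right_mono) simp
    finally show False using dense by (simp add: field_simps)
  qed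
  then obtain y where "d < card {x\<in>S. f x = y}" by blast
  then obtain T where T: "T \<subseteq> {x\<in>S. f x = y}" "card T = Suc d"
    by (meson obtain_subset_with_card_n Suc_leI)
  have "\<bar>s - t\<bar> \<le> int L" if "s \<in> T" "t \<in> T" for s t
  proof -
    have "s div int L = t div int L" using T that by (auto simp: f_def)
    then have "s - t = s mod int L - t mod int L"
      using minus_div_mult_eq_mod[of s "int L"] minus_div_mult_eq_mod[of t "int L"] by simp
    moreover have "0 \<le> s mod int L" "s mod int L < int L" "0 \<le> t mod int L" "t mod int L < int L"
      using L by auto
    ultimately show ?thesis by linarith
  qed
  then show ?thesis using T by blast
qed

section \<open>Lagrange interpolation at integer nodes\<close>

definition nodal_poly :: "int set \<Rightarrow> real poly" where
  "nodal_poly T = (\<Prod>s\<in>T. [:- of_int s, 1:])"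

text \<open>The coefficient of \<open>x ^ i\<close> in the Lagrange basis polynomial that is 1 at \<open>t\<close> and 0 at the other
  nodes.\<close>

definition lagrange_weight :: "int set \<Rightarrow> int \<Rightarrow> nat \<Rightarrow> real" where
  "lagrange_weight T t i = coeff (nodal_poly (T - {t})) i / (\<Prod>s\<in>T - {t}. of_int (t - s))"

text \<open>Up to sign, the discriminant of the nodes, that is, the square of their Vandermonde determinant.
  Each factor \<open>\<Prod>s. t - s\<close> is the denominator of the weights at \<open>t\<close>, so the product over all \<open>t\<close>
  is a common denominator of all weights.\<close>

definition nodal_disc :: "int set \<Rightarrow> int" where
  "nodal_disc T = (\<Prod>t\<in>T. \<Prod>s\<in>T - {t}. t - s)"

lemma degree_nodal_poly: "finite T \<Longrightarrow> degree (nodal_poly T) = card T"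
  unfolding nodal_poly_def by (subst degree_prod_eq_sum_degree) auto

lemma poly_nodal_poly: "poly (nodal_poly T) x = (\<Prod>s\<in>T. x - of_int s)"
  unfolding nodal_poly_def by (simp add: poly_prod algebra_simps)

lemma coeff_by_interpolation:
  fixes c :: "nat \<Rightarrow> real"
  assumes T: "card T = Suc d" and i: "i \<le> d"
  shows "c i = (\<Sum>t\<in>T. (\<Sum>j=0..d. c j * of_int t ^ j) * lagrange_weight T t i)"
proof -
  have fin: "finite T" using T by (simp add: card_ge_0_finite)
  define p where "p = (\<Sum>j=0..d. monom (c j) j)"
  define l where "l = (\<lambda>t. smult (poly p (of_int t) / (\<Prod>s\<in>T - {t}. of_int (t - s))) (nodal_poly (T - {t})))"
  have polyp: "poly p x = (\<Sum>j=0..d. c j * x ^ j)" for x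
    by (simp add: p_def poly_sum poly_monom)
  have "p = (\<Sum>t\<in>T. l t)"
  proof (rule poly_eqI_degree[where A = "real_of_int ` T"])
    fix x assume "x \<in> real_of_int ` T"
    then obtain t where t: "t \<in> T" "x = of_int t" by auto
    have "poly (l u) x = (if u = t then poly p x else 0)" if "u \<in> T" for u
    proof (cases "u = t")
      case True
      have "(\<Prod>s\<in>T - {t}. real_of_int (t - s)) \<noteq> 0" using fin by auto
      then show ?thesis using True t by (simp add: l_def poly_nodal_poly)
    next
      case False
      then have "t \<in> T - {u}" using t by simp
      then have "(\<Prod>s\<in>T - {u}. x - of_int s) = 0" using t fin by (intro prod_zero) auto
      then show ?thesis using False by (simp add: l_def poly_nodal_poly)
    qed
    then show "poly p x = poly (\<Sum>t\<in>T. l t) x"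
      using t fin by (simp add: poly_sum)
  next
    have cardT: "card (real_of_int ` T) = Suc d" using T by (simp add: card_image inj_on_def)
    have "degree p \<le> d"
      unfolding p_def by (rule degree_sum_le) (auto intro: order.trans[OF degree_monom_le])
    then show "degree p < card (real_of_int ` T)" using cardT by simp
    have "degree (l t) \<le> d" if "t \<in> T" for t
      unfolding l_def using that T fin
      by (intro order.trans[OF degree_smult_le]) (simp add: degree_nodal_poly)
    then have "degree (\<Sum>t\<in>T. l t) \<le> d" using fin by (intro degree_sum_le) auto
    then show "degree (\<Sum>t\<in>T. l t) < card (real_of_int ` T)" using cardT by simp
  qed
  then have "coeff p i = (\<Sum>t\<in>T. coeff (l t) i)" by (simp add: coeff_sum)
  moreover have "coeff p i = c i" using i by (simp add: p_def coeff_sum)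
  ultimately show ?thesis by (simp add: l_def lagrange_weight_def polyp)
qed

lemma coeff_nodal_poly_bound:
  assumes "finite A" "\<And>s. s \<in> A \<Longrightarrow> \<bar>of_int s\<bar> \<le> R" "i \<le> card A"
  shows "\<bar>coeff (nodal_poly A) i\<bar> \<le> 2 ^ card A * R ^ (card A - i)"
  using assms
proof (induction A arbitrary: i rule: finite_induct)
  case empty
  then show ?case by (simp add: nodal_poly_def)
next
  case (insert s A)
  have R: "\<bar>real_of_int s\<bar> \<le> R" using insert.prems by simp
  then have R0: "R \<ge> 0" by linarith
  have IH: "\<bar>coeff (nodal_poly A) j\<bar> \<le> 2 ^ card A * R ^ (card A - j)" if "j \<le> card A" for j
    using insert.IH[of j] insert.prems that by simp
  have step: "nodal_poly (insert s A) = [:- of_int s, 1:] * nodal_poly A"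
    using insert.hyps by (simp add: nodal_poly_def)
  have lower: "\<bar>of_int s * coeff (nodal_poly A) i\<bar> \<le> 2 ^ card A * R ^ (Suc (card A) - i)"
  proof (cases "i \<le> card A")
    case True
    have "\<bar>of_int s * coeff (nodal_poly A) i\<bar> \<le> R * (2 ^ card A * R ^ (card A - i))"
      unfolding abs_mult using R IH[OF True] by (intro mult_mono) (use R0 in auto)
    then show ?thesis using True by (simp add: Suc_diff_le algebra_simps)
  next
    case False
    then have "coeff (nodal_poly A) i = 0"
      using insert.hyps by (intro coeff_eq_0) (simp add: degree_nodal_poly)
    then show ?thesis using R0 by simp
  qed
  show ?case
  proof (cases i)
    case 0
    then show ?thesis using lower insert.hyps R0
      by (simp add: step)
  next
    case (Suc j)
    then have "j \<le> card A" using insert by simp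
    from IH[OF this] have "\<bar>coeff (nodal_poly A) j\<bar> \<le> 2 ^ card A * R ^ (Suc (card A) - i)"
      using Suc by simp
    then show ?thesis using lower insert.hyps Suc by (simp add: step)
  qed
qed

text \<open>Used in two ways: with \<open>b = 1\<close> it holds for all integer nodes, and with \<open>b\<close> almost as large as
  \<open>R\<close> it has the decay \<open>R ^ (- i)\<close> that the major arcs ask for.\<close>

lemma lagrange_weight_bound:
  assumes T: "card T = Suc d" "t \<in> T" and R: "\<And>s. s \<in> T \<Longrightarrow> \<bar>of_int s\<bar> \<le> R"
    and b: "0 < b" "\<And>s. s \<in> T \<Longrightarrow> s \<noteq> t \<Longrightarrow> b \<le> \<bar>of_int (t - s)\<bar>" and i: "i \<le> d"
  shows "\<bar>lagrange_weight T t i\<bar> \<le> 2 ^ d * R ^ (d - i) / b ^ d"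
proof -
  have fin: "finite T" using T by (simp add: card_ge_0_finite)
  have card: "card (T - {t}) = d" using T fin by simp
  have "b ^ d = (\<Prod>s\<in>T - {t}. b)" using card by simp
  also have "\<dots> \<le> (\<Prod>s\<in>T - {t}. \<bar>real_of_int (t - s)\<bar>)"
    by (rule prod_mono) (use b in force)
  finally have "b ^ d \<le> \<bar>\<Prod>s\<in>T - {t}. real_of_int (t - s)\<bar>" by (simp add: abs_prod)
  moreover have "\<bar>coeff (nodal_poly (T - {t})) i\<bar> \<le> 2 ^ d * R ^ (d - i)"
    using coeff_nodal_poly_bound[of "T - {t}" R i] fin R i card by simp
  moreover have "0 < b ^ d" using b by simp
  ultimately show ?thesis unfolding lagrange_weight_def abs_divide
    by (intro frac_le) auto
qed

lemma nodal_disc_nz: "finite T \<Longrightarrow> nodal_disc T \<noteq> 0"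
  by (auto simp: nodal_disc_def)

text \<open>This is where clustering pays: the denominator depends on the diameter of the node set only, not on
  the size of the nodes.\<close>

lemma nodal_disc_bound:
  assumes T: "card T = Suc d" and L: "\<And>s t. s \<in> T \<Longrightarrow> t \<in> T \<Longrightarrow> \<bar>s - t\<bar> \<le> int L"
  shows "\<bar>nodal_disc T\<bar> \<le> int L ^ (d * Suc d)"
proof -
  have fin: "finite T" using T by (simp add: card_ge_0_finite)
  have "\<bar>nodal_disc T\<bar> = (\<Prod>t\<in>T. \<Prod>s\<in>T - {t}. \<bar>t - s\<bar>)" by (simp add: nodal_disc_def abs_prod)
  also have "\<dots> \<le> (\<Prod>t\<in>T. \<Prod>s\<in>T - {t}. int L)"
    using L by (intro prod_mono conjI prod_nonneg) auto
  also have "\<dots> = (\<Prod>t\<in>T. int L ^ d)" using T fin by (intro prod.cong) auto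
  also have "\<dots> = int L ^ (d * Suc d)" using T by (simp only: prod_constant power_mult)
  finally show ?thesis .
qed

lemma nodal_disc_clears_weight:
  assumes "finite T" "t \<in> T"
  shows "of_int (nodal_disc T) * lagrange_weight T t i \<in> \<int>"
proof -
  define P where "P = (\<Prod>s\<in>T - {t}. t - s)"
  have P: "P \<noteq> 0" using assms by (auto simp: P_def)
  have "nodal_disc T = P * (\<Prod>t\<in>T - {t}. \<Prod>s\<in>T - {t}. t - s)"
    unfolding nodal_disc_def P_def using assms by (subst prod.remove[of _ t]) auto
  then obtain k where k: "nodal_disc T = P * k" by blast
  have "coeff (nodal_poly A) i \<in> \<int>" for A
  proof (induction A arbitrary: i rule: infinite_finite_induct)
    case (insert s A)
    have "nodal_poly (insert s A) = [:- of_int s, 1:] * nodal_poly A"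
      using insert.hyps by (simp add: nodal_poly_def)
    then show ?case using insert.IH by (cases i) (auto simp: coeff_pCons)
  qed (auto simp: nodal_poly_def coeff_1)
  moreover have "of_int (nodal_disc T) * lagrange_weight T t i
      = of_int k * coeff (nodal_poly (T - {t})) i"
  proof -
    have "(\<Prod>s\<in>T - {t}. real_of_int (t - s)) = of_int P" by (simp add: P_def)
    then show ?thesis using P by (simp add: lagrange_weight_def k)
  qed
  ultimately show ?thesis by simp
qed

section \<open>Polynomials that are often close to a rational number modulo 1\<close>

text \<open>Suppose that the polynomial with coefficients \<open>c\<close> is within \<open>\<epsilon>\<close> of \<open>\<theta>\<close> modulo 1 on two node sets. On
  \<open>TA\<close>, replacing its values by the nearby numbers \<open>\<theta> + k\<close> and interpolating gives rational
  coefficients \<open>r\<close> whose denominator divides \<open>q * nodal_disc TA\<close>; at this stage \<open>c - r\<close> is only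
  known to be small up to powers of \<open>R\<close>. The point is that this crude bound makes \<open>r\<close> exact on \<open>TB\<close>:
  at a node of \<open>TB\<close> the value of \<open>r\<close> differs from \<open>\<theta> + k\<close> by less than the reciprocal of its
  denominator, hence not at all. So \<open>c - r\<close> is bounded by \<open>\<epsilon>\<close> itself on \<open>TB\<close>, and a second
  interpolation, now at well separated nodes, gives the sharp bound.\<close>

lemma rational_coefficients:
  fixes c :: "nat \<Rightarrow> real" and TA TB :: "int set" and q :: int
  assumes TA: "card TA = Suc d" and TB: "card TB = Suc d"
    and near: "\<And>t. t \<in> TA \<union> TB \<Longrightarrow>
      \<exists>k::int. \<bar>(\<Sum>j=0..d. c j * of_int t ^ j) - \<theta> - of_int k\<bar> \<le> \<epsilon>"
    and R: "\<And>t. t \<in> TA \<union> TB \<Longrightarrow> \<bar>of_int t\<bar> \<le> R" "1 \<le> R"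
    and sep: "0 < b" "\<And>s t. s \<in> TB \<Longrightarrow> t \<in> TB \<Longrightarrow> s \<noteq> t \<Longrightarrow> b \<le> \<bar>of_int (s - t)\<bar>"
    and q: "of_int q * \<theta> \<in> \<int>" "q \<noteq> 0"
    and small: "2 * real (Suc d) ^ 2 * 2 ^ d * R ^ (2 * d) * \<epsilon> * \<bar>of_int (q * nodal_disc TA)\<bar> < 1"
  shows "\<exists>r. \<forall>i\<le>d. of_int (q * nodal_disc TA) * r i \<in> \<int> \<and>
           \<bar>c i - r i\<bar> \<le> real (Suc d) * (2 ^ d * R ^ (d - i) / b ^ d) * \<epsilon>"
proof -
  have fin: "finite TA" "finite TB" using TA TB by (simp_all add: card_ge_0_finite)
  define val where "val = (\<lambda>t::int. \<Sum>j=0..d. c j * of_int t ^ j)"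
  obtain k :: "int \<Rightarrow> int" where
    k: "\<And>t. t \<in> TA \<union> TB \<Longrightarrow> \<bar>val t - \<theta> - of_int (k t)\<bar> \<le> \<epsilon>"
    using near unfolding val_def by metis
  have eps: "0 \<le> \<epsilon>"
  proof -
    obtain t where "t \<in> TA" using TA by fastforce
    then show ?thesis using k[of t] by force
  qed
  define D where "D = real_of_int (q * nodal_disc TA)"
  have D: "D \<noteq> 0" using q nodal_disc_nz[OF fin(1)] by (simp add: D_def)
  \<comment> \<open>interpolation of the idealised values \<open>\<theta> + k t\<close> on \<open>TA\<close>\<close>
  define r where "r = (\<lambda>i. \<Sum>t\<in>TA. (\<theta> + of_int (k t)) * lagrange_weight TA t i)"
  have integral: "D * r i \<in> \<int>" for i
  proof -
    have "D * r i = (\<Sum>t\<in>TA. (of_int q * \<theta> + of_int (q * k t)) *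
        (of_int (nodal_disc TA) * lagrange_weight TA t i))"
      by (simp add: D_def r_def sum_distrib_left algebra_simps)
    also have "\<dots> \<in> \<int>"
      by (intro Ints_sum Ints_mult[OF Ints_add[OF q(1) Ints_of_int]]
          nodal_disc_clears_weight[OF fin(1)])
    finally show ?thesis .
  qed
  have crude: "\<bar>c i - r i\<bar> \<le> real (Suc d) * 2 ^ d * R ^ d * \<epsilon>" if "i \<le> d" for i
  proof -
    have "c i - r i = (\<Sum>t\<in>TA. (val t - \<theta> - of_int (k t)) * lagrange_weight TA t i)"
      unfolding r_def coeff_by_interpolation[OF TA that, of c] sum_subtractf[symmetric] val_def
      by (intro sum.cong) (auto simp: algebra_simps)
    also have "\<bar>\<dots>\<bar> \<le> (\<Sum>t\<in>TA. \<epsilon> * (2 ^ d * R ^ d))"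
    proof (rule order.trans[OF sum_abs], rule sum_mono)
      fix t assume t: "t \<in> TA"
      have "\<bar>lagrange_weight TA t i\<bar> \<le> 2 ^ d * R ^ (d - i) / 1 ^ d"
        by (rule lagrange_weight_bound[OF TA t]) (use R that in force)+
      also have "\<dots> \<le> 2 ^ d * R ^ d" using R(2) by (simp add: power_increasing)
      finally show "\<bar>(val t - \<theta> - of_int (k t)) * lagrange_weight TA t i\<bar> \<le> \<epsilon> * (2 ^ d * R ^ d)"
        unfolding abs_mult using k[of t] t eps by (intro mult_mono) auto
    qed
    finally show ?thesis using TA by (simp add: algebra_simps)
  qed
  define rv where "rv = (\<lambda>t::int. \<Sum>j=0..d. r j * of_int t ^ j)"
  have diff: "val t - rv t = (\<Sum>j=0..d. (c j - r j) * of_int t ^ j)" for t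
    by (simp add: val_def rv_def sum_subtractf algebra_simps)
  have exact: "rv t = \<theta> + of_int (k t)" if t: "t \<in> TB" for t
  proof -
    have "\<bar>val t - rv t\<bar> \<le> (\<Sum>j=0..d. (real (Suc d) * 2 ^ d * R ^ d * \<epsilon>) * R ^ d)"
      unfolding diff
    proof (rule order.trans[OF sum_abs], rule sum_mono)
      fix j assume j: "j \<in> {0..d}"
      have "\<bar>of_int t\<bar> ^ j \<le> R ^ j" using R(1)[of t] t by (intro power_mono) auto
      also have "\<dots> \<le> R ^ d" using R(2) j by (intro power_increasing) auto
      finally show "\<bar>(c j - r j) * of_int t ^ j\<bar> \<le> (real (Suc d) * 2 ^ d * R ^ d * \<epsilon>) * R ^ d"
        unfolding abs_mult power_abs using crude[of j] j eps R(2) by (intro mult_mono) auto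
    qed
    also have "\<dots> = real (Suc d) ^ 2 * 2 ^ d * R ^ (2 * d) * \<epsilon>"
    proof -
      have "R ^ (2 * d) = R ^ d * R ^ d" by (simp add: mult_2 power_add)
      then show ?thesis by (simp add: power2_eq_square mult_ac del: of_nat_Suc)
    qed
    finally have 1: "\<bar>val t - rv t\<bar> \<le> real (Suc d) ^ 2 * 2 ^ d * R ^ (2 * d) * \<epsilon>" .
    have "1 \<le> real (Suc d) ^ 2 * 2 ^ d * R ^ (2 * d)"
      using R(2) by (intro mult_ge1_I one_le_power) auto
    then have 2: "\<epsilon> \<le> real (Suc d) ^ 2 * 2 ^ d * R ^ (2 * d) * \<epsilon>"
      using eps mult_right_mono by fastforce
    have "\<bar>rv t - \<theta> - of_int (k t)\<bar> \<le> 2 * real (Suc d) ^ 2 * 2 ^ d * R ^ (2 * d) * \<epsilon>"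
      using 1 2 k[of t] t unfolding mult.assoc by force
    then have "\<bar>D * (rv t - \<theta> - of_int (k t))\<bar> \<le>
        \<bar>D\<bar> * (2 * real (Suc d) ^ 2 * 2 ^ d * R ^ (2 * d) * \<epsilon>)"
      unfolding abs_mult by (rule mult_left_mono) simp
    also have "\<dots> < 1" using small by (simp add: D_def algebra_simps)
    finally have lt: "\<bar>D * (rv t - \<theta> - of_int (k t))\<bar> < 1" .
    \<comment> \<open>an integer of absolute value less than 1\<close>
    have "D * (rv t - \<theta> - of_int (k t)) =
        (\<Sum>j=0..d. (D * r j) * of_int t ^ j)
          - of_int (nodal_disc TA) * (of_int q * \<theta>) - of_int (q * nodal_disc TA * k t)"
      by (simp add: rv_def D_def sum_distrib_left algebra_simps)
    also have "\<dots> \<in> \<int>"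
      by (intro Ints_diff Ints_sum Ints_mult[OF integral Ints_power[OF Ints_of_int]]
          Ints_mult[OF Ints_of_int q(1)] Ints_of_int)
    finally have "D * (rv t - \<theta> - of_int (k t)) = 0" using lt Ints_nonzero_abs_less1 by blast
    then show ?thesis using D by simp
  qed
  have "\<bar>c i - r i\<bar> \<le> real (Suc d) * (2 ^ d * R ^ (d - i) / b ^ d) * \<epsilon>" if i: "i \<le> d" for i
  proof -
    have "c i - r i = (\<Sum>t\<in>TB. (val t - rv t) * lagrange_weight TB t i)"
      unfolding diff by (rule coeff_by_interpolation[OF TB i])
    also have "\<bar>\<dots>\<bar> \<le> (\<Sum>t\<in>TB. \<epsilon> * (2 ^ d * R ^ (d - i) / b ^ d))"
    proof (rule order.trans[OF sum_abs], rule sum_mono)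
      fix t assume t: "t \<in> TB"
      have "\<bar>lagrange_weight TB t i\<bar> \<le> 2 ^ d * R ^ (d - i) / b ^ d"
        by (rule lagrange_weight_bound[OF TB t _ sep(1) _ i]) (use R sep(2) t in auto)
      then show "\<bar>(val t - rv t) * lagrange_weight TB t i\<bar> \<le> \<epsilon> * (2 ^ d * R ^ (d - i) / b ^ d)"
        unfolding abs_mult exact[OF t] using k[of t] t eps
        by (intro mult_mono) (auto simp: algebra_simps)
    qed
    finally show ?thesis using TB by (simp add: algebra_simps)
  qed
  then show ?thesis using integral by (intro exI[of _ r]) (simp add: D_def)
qed

section \<open>Rational points of the torus\<close>

lemma torus_rep_range: "- (1/2) \<le> torus_rep x" "torus_rep x < 1/2"
  unfolding torus_rep_def by linarith+

lemma abs_torus_rep_le: "\<bar>torus_rep x\<bar> \<le> \<bar>x - of_int k\<bar>"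
proof (cases "k = \<lfloor>x + 1/2\<rfloor>")
  case False
  then have "1 \<le> \<bar>real_of_int (\<lfloor>x + 1/2\<rfloor> - k)\<bar>" by linarith
  then show ?thesis using torus_rep_range[of x] unfolding torus_rep_def by (simp add: abs_if split: if_splits)
qed (simp add: torus_rep_def)

lemma torus_rep_cong: "\<exists>k::int. torus_rep x = x - of_int k"
  unfolding torus_rep_def by blast

lemma torus_diff_triangle: "\<bar>torus_diff x z\<bar> \<le> \<bar>torus_diff x y\<bar> + \<bar>torus_diff y z\<bar>"
proof -
  obtain k l :: int where "torus_diff x y = x - y - of_int k" "torus_diff y z = y - z - of_int l"
    unfolding torus_diff_def using torus_rep_cong by metis
  moreover have "\<bar>torus_diff x z\<bar> \<le> \<bar>(x - z) - of_int (k + l)\<bar>"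
    unfolding torus_diff_def by (rule abs_torus_rep_le)
  ultimately show ?thesis by simp
qed

lemma torus_diff_commute: "\<bar>torus_diff x y\<bar> = \<bar>torus_diff y x\<bar>"
proof -
  have "\<bar>torus_diff u v\<bar> \<le> \<bar>torus_diff v u\<bar>" for u v
  proof -
    obtain k :: int where "torus_diff v u = v - u - of_int k"
      unfolding torus_diff_def using torus_rep_cong by metis
    then show ?thesis using abs_torus_rep_le[of "u - v" "-k"] unfolding torus_diff_def by simp
  qed
  then show ?thesis by (meson order.antisym)
qed

text \<open>Any common denominator will do: dividing it and the numerators by their greatest common divisor
  yields the reduced representation without increasing the denominator.\<close>

lemma mem_Sigma_le:
  assumes \<omega>: "\<omega> \<in> torus L" and Q: "1 \<le> Q" "Q \<le> 2 ^ l"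
    and int: "\<And>\<gamma>. \<gamma> \<in> L \<Longrightarrow> real Q * \<omega> \<gamma> \<in> \<int>"
  shows "\<omega> \<in> Sigma_le L l"
proof -
  define a where "a = (\<lambda>\<gamma>. \<lfloor>real Q * \<omega> \<gamma>\<rfloor>)"
  have a: "of_int (a \<gamma>) = real Q * \<omega> \<gamma>" if "\<gamma> \<in> L" for \<gamma>
    using int[OF that] by (auto simp: a_def elim: Ints_cases)
  define g where "g = Gcd (insert (int Q) (a ` L))"
  have gdvd: "g dvd int Q" "\<And>\<gamma>. \<gamma> \<in> L \<Longrightarrow> g dvd a \<gamma>"
    unfolding g_def by (rule Gcd_dvd, blast)+
  have "g \<noteq> 0" using gdvd(1) Q by auto
  moreover have "g \<ge> 0" by (simp add: g_def)
  ultimately have g: "g > 0" by simp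
  define q where "q = nat (int Q div g)"
  define a' where "a' = (\<lambda>\<gamma>. a \<gamma> div g)"
  have qg: "int q * g = int Q" using gdvd(1) g by (simp add: q_def pos_imp_zdiv_nonneg_iff)
  have ag: "a' \<gamma> * g = a \<gamma>" if "\<gamma> \<in> L" for \<gamma> using gdvd(2)[OF that] by (simp add: a'_def)
  have q1: "1 \<le> q" using qg Q by (cases q) auto
  define h where "h = Gcd (insert (int q) (a' ` L))"
  have "h * g dvd g"
    unfolding g_def
  proof (rule Gcd_greatest)
    fix x assume "x \<in> insert (int Q) (a ` L)"
    then consider "x = int q * g" | \<gamma> where "\<gamma> \<in> L" "x = a' \<gamma> * g" using qg ag by auto
    then show "h * Gcd (insert (int Q) (a ` L)) dvd x"
      unfolding g_def[symmetric]
    proof cases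
      case 1
      then show "h * g dvd x" unfolding h_def by (auto intro!: mult_dvd_mono Gcd_dvd simp del: Gcd_insert)
    next
      case (2 \<gamma>)
      then show "h * g dvd x" unfolding h_def by (auto intro!: mult_dvd_mono Gcd_dvd simp del: Gcd_insert)
    qed
  qed
  then have "h dvd 1" using g by simp
  moreover have "h \<ge> 0" by (simp add: h_def)
  ultimately have "h = 1" by (simp add: zdvd1_eq)
  then have "reduced_frac L a' q" using q1 by (simp add: reduced_frac_def h_def)
  moreover have "int q \<le> int Q"
  proof -
    have "int q * 1 \<le> int q * g" using g by (intro mult_left_mono) auto
    then show ?thesis using qg by simp
  qed
  then have "q \<le> 2 ^ l" using Q by linarith
  moreover have "\<omega> \<gamma> = of_int (a' \<gamma>) / of_nat q" if "\<gamma> \<in> L" for \<gamma>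
  proof -
    have "of_int (a' \<gamma>) * of_int g = real q * of_int g * \<omega> \<gamma>"
      using a[OF that] ag[OF that] qg by (metis of_int_mult of_int_of_nat_eq)
    then show ?thesis using g q1 by (simp add: field_simps)
  qed
  ultimately show ?thesis using \<omega> unfolding Sigma_le_def by blast
qed

lemma Sigma_le_denominator:
  assumes "\<omega> \<in> Sigma_le L l"
  obtains q where "1 \<le> q" "q \<le> 2 ^ l" "\<And>\<gamma>. \<gamma> \<in> L \<Longrightarrow> real q * \<omega> \<gamma> \<in> \<int>"
proof -
  obtain a q where "reduced_frac L a q" "q \<le> 2 ^ l" "\<forall>\<gamma>\<in>L. \<omega> \<gamma> = of_int (a \<gamma>) / of_nat q"
    using assms by (auto simp: Sigma_le_def)
  then show ?thesis using that[of q] by (auto simp: reduced_frac_def)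
qed

text \<open>Two different fractions with denominators \<open>q\<close> and \<open>q'\<close> are at distance at least \<open>1 / (q q')\<close>
  modulo 1.\<close>

lemma Sigma_le_separated:
  assumes \<omega>: "\<omega> \<in> Sigma_le L l" and \<omega>': "\<omega>' \<in> Sigma_le L l" and "\<omega> \<noteq> \<omega>'"
  shows "\<exists>\<gamma>\<in>L. 1 / 4 ^ l \<le> \<bar>torus_diff (\<omega> \<gamma>) (\<omega>' \<gamma>)\<bar>"
proof -
  have tor: "\<omega> \<in> torus L" "\<omega>' \<in> torus L" using assms by (auto simp: Sigma_le_def)
  obtain \<gamma> where \<gamma>: "\<gamma> \<in> L" "\<omega> \<gamma> \<noteq> \<omega>' \<gamma>"
    using PiE_ext[of \<omega> L "\<lambda>_. {-1/2..<1/2}" \<omega>'] tor assms(3) unfolding torus_def by blast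
  obtain q where q: "1 \<le> q" "q \<le> 2 ^ l" "real q * \<omega> \<gamma> \<in> \<int>"
    using Sigma_le_denominator[OF \<omega>] \<gamma>(1) by metis
  obtain q' where q': "1 \<le> q'" "q' \<le> 2 ^ l" "real q' * \<omega>' \<gamma> \<in> \<int>"
    using Sigma_le_denominator[OF \<omega>'] \<gamma>(1) by metis
  obtain k :: int where k: "torus_diff (\<omega> \<gamma>) (\<omega>' \<gamma>) = \<omega> \<gamma> - \<omega>' \<gamma> - of_int k"
    unfolding torus_diff_def using torus_rep_cong by metis
  have "\<omega> \<gamma> \<in> {-1/2..<1/2}" "\<omega>' \<gamma> \<in> {-1/2..<1/2}"
    using tor \<gamma>(1) unfolding torus_def by blast+
  then have ne: "\<omega> \<gamma> - \<omega>' \<gamma> - of_int k \<noteq> 0" using \<gamma>(2)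
  proof (cases "k = 0")
    case False
    then have "1 \<le> \<bar>real_of_int k\<bar>" by linarith
    moreover have "\<bar>\<omega> \<gamma> - \<omega>' \<gamma>\<bar> < 1"
      using \<open>\<omega> \<gamma> \<in> _\<close> \<open>\<omega>' \<gamma> \<in> _\<close> by (simp add: abs_if)
    ultimately show ?thesis by force
  qed simp
  have "real (q * q') * (\<omega> \<gamma> - \<omega>' \<gamma> - of_int k) =
      real q' * (real q * \<omega> \<gamma>) - real q * (real q' * \<omega>' \<gamma>) - of_int (int (q * q') * k)"
    by (simp add: algebra_simps)
  also have "\<dots> \<in> \<int>" 
    by (intro Ints_diff Ints_mult[OF Ints_of_nat q(3)] Ints_mult[OF Ints_of_nat q'(3)] Ints_of_int)
  finally have "1 \<le> \<bar>real (q * q') * (\<omega> \<gamma> - \<omega>' \<gamma> - of_int k)\<bar>"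
    using ne q(1) q'(1) Ints_nonzero_abs_ge1 by force
  also have "\<dots> = real (q * q') * \<bar>torus_diff (\<omega> \<gamma>) (\<omega>' \<gamma>)\<bar>" by (simp add: abs_mult k)
  also have "\<dots> \<le> 4 ^ l * \<bar>torus_diff (\<omega> \<gamma>) (\<omega>' \<gamma>)\<bar>"
  proof (rule mult_right_mono)
    have "q * q' \<le> 2 ^ l * 2 ^ l" using q q' by (intro mult_mono) auto
    also have "\<dots> = 4 ^ l" by (simp flip: power_mult_distrib)
    finally show "real (q * q') \<le> 4 ^ l" by (metis of_nat_le_iff of_nat_numeral of_nat_power)
  qed simp
  finally show ?thesis using \<gamma>(1) by (intro bexI[of _ \<gamma>]) (simp_all add: field_simps)
qed

lemma Sigma_le_card:
  assumes "finite L"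
  shows "finite (Sigma_le L l)" "card (Sigma_le L l) \<le> 2 ^ l * (3 * 2 ^ l) ^ card L"
proof -
  define F where "F = (\<lambda>q::nat. L \<rightarrow>\<^sub>E (\<lambda>a::int. of_int a / real q) ` {- int q..int q})"
  have sub: "Sigma_le L l \<subseteq> (\<Union>q\<in>{1..2 ^ l}. F q)"
  proof
    fix \<omega> assume \<omega>: "\<omega> \<in> Sigma_le L l"
    obtain q where q: "1 \<le> q" "q \<le> 2 ^ l" "\<And>\<gamma>. \<gamma> \<in> L \<Longrightarrow> real q * \<omega> \<gamma> \<in> \<int>"
      using Sigma_le_denominator[OF \<omega>] by metis
    have tor: "\<omega> \<in> torus L" using \<omega> by (simp add: Sigma_le_def)
    have "\<omega> \<gamma> \<in> (\<lambda>a::int. of_int a / real q) ` {- int q..int q}" if \<gamma>: "\<gamma> \<in> L" for \<gamma>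
    proof -
      obtain a where a: "real q * \<omega> \<gamma> = of_int a" using q(3)[OF \<gamma>] by (auto elim: Ints_cases)
      have "\<omega> \<gamma> \<in> {-1/2..<1/2}" using tor \<gamma> unfolding torus_def by blast
      then have "- 1 \<le> \<omega> \<gamma>" "\<omega> \<gamma> \<le> 1" by auto
      then have "real q * (-1) \<le> of_int a" "of_int a \<le> real q * 1"
        unfolding a[symmetric] by (intro mult_left_mono; simp)+
      then have "a \<in> {- int q..int q}" by auto
      moreover have "\<omega> \<gamma> = of_int a / real q" using a q(1) by (simp add: field_simps)
      ultimately show ?thesis by blast
    qed
    then have "\<omega> \<in> F q" using tor unfolding F_def torus_def by (auto simp: PiE_iff)
    then show "\<omega> \<in> (\<Union>q\<in>{1..2 ^ l}. F q)" using q by auto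
  qed
  have finF: "finite (F q)" for q unfolding F_def using assms by (intro finite_PiE) auto
  have fin: "finite (\<Union>q\<in>{1..2 ^ l}. F q)" using finF by blast
  then show "finite (Sigma_le L l)" using sub finite_subset by blast
  have cardF: "card (F q) \<le> (3 * 2 ^ l) ^ card L" if q: "q \<in> {1..2 ^ l}" for q
  proof -
    have "card ((\<lambda>a::int. of_int a / real q) ` {- int q..int q}) \<le> card {- int q..int q}"
      by (rule card_image_le) simp
    also have "\<dots> \<le> 3 * 2 ^ l"
    proof -
      have "nat (int q + 1 + int q) = 2 * q + 1" by simp
      then show ?thesis using q by simp
    qed
    finally have "card ((\<lambda>a::int. of_int a / real q) ` {- int q..int q}) ^ card L \<le> (3 * 2 ^ l) ^ card L"
      by (rule power_mono) simp
    then show ?thesis unfolding F_def using assms by (simp add: card_PiE)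
  qed
  have "card (Sigma_le L l) \<le> card (\<Union>q\<in>{1..2 ^ l}. F q)" using sub fin by (rule card_mono[rotated])
  also have "\<dots> \<le> (\<Sum>q\<in>{1..2 ^ l}. card (F q))" by (rule card_UN_le) simp
  also have "\<dots> \<le> (\<Sum>q\<in>{1..(2::nat) ^ l}. (3 * 2 ^ l) ^ card L)" by (rule sum_mono) (rule cardF)
  finally show "card (Sigma_le L l) \<le> 2 ^ l * (3 * 2 ^ l) ^ card L" by simp
qed

section \<open>The major-arc projection near a rational point\<close>

lemma powi_Log:
  assumes "0 < X"
  shows "2 powi Log X \<le> X" "X < 2 * 2 powi Log X"
proof -
  have eq: "(2::real) powi Log X = 2 powr of_int (Log X)" by (simp add: powr_real_of_int')
  have "of_int (Log X) \<le> log 2 X" "log 2 X < of_int (Log X) + 1" unfolding Log_def by linarith+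
  then have "2 powr of_int (Log X) \<le> 2 powr log 2 X" "2 powr log 2 X < 2 powr (of_int (Log X) + 1)"
    by (simp_all del: powr_log_cancel)
  then show "2 powi Log X \<le> X" "X < 2 * 2 powi Log X" using assms by (simp_all add: eq powr_add)
qed

lemma lvl_bounds:
  assumes "1 \<le> K"
  shows "2 ^ lvl K \<le> K" "K < 2 * 2 ^ lvl K"
proof -
  have "0 \<le> Log K" using assms by (simp add: Log_def)
  then have "(2::real) ^ lvl K = 2 powi Log K" by (simp add: lvl_def power_int_def)
  then show "2 ^ lvl K \<le> K" "K < 2 * 2 ^ lvl K" using powi_Log[of K] assms by auto
qed

lemma cutoff_eq_1:
  assumes "cutoff \<eta>" "\<bar>x\<bar> \<le> 1/4" shows "\<eta> x = 1"
proof -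
  have "indicator {-1/4..1/4} x \<le> \<eta> x" "\<eta> x \<le> 1" using assms(1) by (auto simp: cutoff_def)
  moreover have "x \<in> {-1/4..1/4}" using assms(2) by auto
  ultimately show ?thesis by (simp add: indicator_def)
qed

lemma cutoff_nz:
  assumes "cutoff \<eta>" "\<eta> x \<noteq> 0" shows "\<bar>x\<bar> \<le> 1/2"
proof (rule ccontr)
  assume "\<not> ?thesis"
  then have "x \<notin> {-1/2..1/2}" by auto
  moreover have "0 \<le> \<eta> x" "\<eta> x \<le> indicator {-1/2..1/2} x" using assms(1) by (auto simp: cutoff_def)
  moreover have "indicator {-1/2..1/2} x = (0::real)" using \<open>x \<notin> _\<close> by (simp add: indicator_def del: atLeastAtMost_iff)
  ultimately show False using assms(2) by simp
qed

text \<open>The dyadic factor lies in \<open>(X / 2, X]\<close>. Its rounding is absorbed by the gap between the intervals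
  on which a cutoff is 1 and outside of which it vanishes, which leads to the two radii
  \<open>1 / (4 X)\<close> here and \<open>1 / X\<close> in the next lemma.\<close>

lemma cutoff_scaled_eq_1:
  assumes "cutoff \<eta>" "0 < X" "\<bar>x\<bar> \<le> 1 / (4 * X)" shows "\<eta> (2 powi Log X * x) = 1"
proof (rule cutoff_eq_1[OF assms(1)])
  have "\<bar>2 powi Log X * x\<bar> \<le> X * (1 / (4 * X))"
    unfolding abs_mult using powi_Log(1)[OF assms(2)] assms by (intro mult_mono) auto
  then show "\<bar>2 powi Log X * x\<bar> \<le> 1/4" using assms(2) by simp
qed

lemma cutoff_scaled_nz:
  assumes "cutoff \<eta>" "0 < X" "\<eta> (2 powi Log X * x) \<noteq> 0" shows "\<bar>x\<bar> \<le> 1 / X"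
proof -
  have "\<bar>2 powi Log X * x\<bar> \<le> 1/2" using cutoff_nz[OF assms(1,3)] .
  then have h: "2 * 2 powi Log X * \<bar>x\<bar> \<le> 1" by (simp add: abs_mult)
  have "X * \<bar>x\<bar> \<le> 2 * 2 powi Log X * \<bar>x\<bar>" using powi_Log(2)[OF assms(2)] by (intro mult_right_mono) auto
  then show ?thesis using h assms(2) by (simp add: field_simps)
qed

text \<open>The summand of \<open>\<omega>\<close> is 1. Any other rational point is so far from \<open>\<omega>\<close> in some coordinate, compared
  with the width \<open>1 / X\<close> of the cutoffs, that its summand vanishes.\<close>

lemma major_proj_eq_1:
  assumes \<eta>: "cutoff \<eta>" and pos: "0 < M" "0 < N"
    and \<omega>: "\<omega> \<in> Sigma_le (Idx2 d1 d2) (lvl (M powr u))"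
    and near: "\<And>g1 g2. g1 \<le> d1 \<Longrightarrow> 1 \<le> g2 \<Longrightarrow> g2 \<le> d2 \<Longrightarrow>
      \<bar>torus_diff (\<xi> (g1, g2)) (\<omega> (g1, g2))\<bar> \<le> 1 / (4 * (M ^ g1 * N ^ g2 / M powr chi))"
    and scale: "\<And>g1 g2. g1 \<le> d1 \<Longrightarrow> 1 \<le> g2 \<Longrightarrow> g2 \<le> d2 \<Longrightarrow>
      2 / (M ^ g1 * N ^ g2 / M powr chi) < 1 / 4 ^ lvl (M powr u)"
  shows "major_proj d1 d2 \<eta> chi u M N \<xi> = 1"
proof -
  define X where "X = (\<lambda>(g1,g2). M ^ g1 * N ^ g2 / M powr chi)"
  have X: "0 < X \<gamma>" for \<gamma> using pos by (auto simp: X_def split: prod.splits)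
  define F where "F = (\<lambda>\<omega>. \<Prod>\<gamma>\<in>Idx2 d1 d2. \<eta> (2 powi Log (X \<gamma>) * torus_diff (\<xi> \<gamma>) (\<omega> \<gamma>)))"
  have proj: "major_proj d1 d2 \<eta> chi u M N \<xi> = (\<Sum>\<omega>\<in>Sigma_le (Idx2 d1 d2) (lvl (M powr u)). F \<omega>)"
    unfolding major_proj_def F_def X_def by (intro sum.cong prod.cong) auto
  have fin: "finite (Idx2 d1 d2)" by (simp add: Idx2_def)
  have near': "\<bar>torus_diff (\<xi> \<gamma>) (\<omega> \<gamma>)\<bar> \<le> 1 / (4 * X \<gamma>)" if "\<gamma> \<in> Idx2 d1 d2" for \<gamma>
    using near that by (auto simp: Idx2_def X_def)
  have "F \<omega> = 1"
    unfolding F_def using cutoff_scaled_eq_1[OF \<eta> X near'] by (intro prod.neutral) auto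
  moreover have "F \<omega>' = 0" if \<omega>': "\<omega>' \<in> Sigma_le (Idx2 d1 d2) (lvl (M powr u))" "\<omega>' \<noteq> \<omega>" for \<omega>'
  proof -
    obtain \<gamma> where \<gamma>: "\<gamma> \<in> Idx2 d1 d2"
      "1 / 4 ^ lvl (M powr u) \<le> \<bar>torus_diff (\<omega> \<gamma>) (\<omega>' \<gamma>)\<bar>"
      using Sigma_le_separated[OF \<omega> \<omega>'(1)] \<omega>'(2) by blast
    have "2 / X \<gamma> < 1 / 4 ^ lvl (M powr u)" using scale \<gamma>(1) by (auto simp: Idx2_def X_def)
    moreover have "\<bar>torus_diff (\<omega> \<gamma>) (\<omega>' \<gamma>)\<bar> \<le> \<bar>torus_diff (\<xi> \<gamma>) (\<omega> \<gamma>)\<bar> + \<bar>torus_diff (\<xi> \<gamma>) (\<omega>' \<gamma>)\<bar>"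
      using torus_diff_triangle[of "\<omega> \<gamma>" "\<omega>' \<gamma>" "\<xi> \<gamma>"] torus_diff_commute[of "\<omega> \<gamma>" "\<xi> \<gamma>"] by simp
    moreover have "\<bar>torus_diff (\<xi> \<gamma>) (\<omega> \<gamma>)\<bar> \<le> 1 / X \<gamma>"
      using near'[OF \<gamma>(1)] X[of \<gamma>] by (simp add: field_simps)
    ultimately have "\<not> \<bar>torus_diff (\<xi> \<gamma>) (\<omega>' \<gamma>)\<bar> \<le> 1 / X \<gamma>" using \<gamma>(2) by simp
    then have "\<eta> (2 powi Log (X \<gamma>) * torus_diff (\<xi> \<gamma>) (\<omega>' \<gamma>)) = 0"
      using cutoff_scaled_nz[OF \<eta> X] by blast
    then show ?thesis unfolding F_def using fin \<gamma>(1) by (intro prod_zero) auto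
  qed
  ultimately show ?thesis
    unfolding proj using \<omega> Sigma_le_card(1)[OF fin]
    by (subst sum.remove[of _ \<omega>]) (auto intro!: sum.neutral)
qed

section \<open>A dense set of good integers forces a major arc\<close>

text \<open>With at least about \<open>M powr (1 - \<kappa>)\<close> elements, \<open>S\<close> contains \<open>d1 + 1\<close> points in an interval of
  length about \<open>M powr \<kappa>\<close> and \<open>d1 + 1\<close> points separated by \<open>M powr (1 - \<kappa>)\<close>. Both node sets are
  chosen before \<open>g2\<close>, so the rational approximations for the different \<open>g2\<close> share one denominator,
  \<open>\<bar>Q\<bar> \<le> 2 ^ (d1 (d1 + 1)) * M powr (u2 + \<kappa> d1 (d1 + 1))\<close>, which \<open>\<kappa> d1 (d1 + 1) \<le> u1 / 8\<close> keeps
  below \<open>M powr u1\<close>. The approximation error in the coefficient of \<open>m ^ i\<close> is about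
  \<open>M powr (\<kappa> d1 + chi2 - i) / N ^ g2\<close>, well inside the major arc of width
  \<open>M powr (chi1 - i) / N ^ g2\<close>. The lower bound on \<open>M powr (u1 / 2)\<close> absorbs every
  numerical constant, and the one on \<open>N\<close> every fixed power of \<open>M\<close>.\<close>

lemma dense_forces_major_arc:
  fixes M N \<kappa> u1 chi1 u2 chi2 :: real and d1 d2 :: nat
  assumes \<eta>: "cutoff \<eta>" and d1: "1 \<le> d1"
    and u1: "0 < u1" "8 * u1 \<le> chi1" "chi1 \<le> 1"
    and small: "0 < u2" "u2 \<le> u1 / 8" "0 < chi2" "chi2 \<le> u1 / 8"
    and \<kappa>: "0 < \<kappa>" "\<kappa> * real (d1 * Suc d1) \<le> u1 / 8"
    and M: "1 \<le> M" "real (Suc d1) ^ 2 * 2 ^ (d1 * Suc d1 + 4 * d1 + 4) \<le> M powr (u1 / 2)"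
    and N: "M ^ (100 * Suc d1) \<le> N"
    and S: "finite S" "\<And>m. m \<in> S \<Longrightarrow> M < of_int m \<and> of_int m \<le> 2 * M"
    and \<theta>: "\<theta> \<in> Sigma_le {1..d2} (lvl (M powr u2))"
    and near: "\<And>m g2. m \<in> S \<Longrightarrow> 1 \<le> g2 \<Longrightarrow> g2 \<le> d2 \<Longrightarrow>
      \<bar>torus_diff (frac (slice d1 \<xi> m g2)) (\<theta> g2)\<bar> \<le> M powr chi2 / N ^ g2"
    and dense: "6 * real (Suc d1) * M powr (1 - \<kappa>) < real (card S)"
  shows "major_proj d1 d2 \<eta> chi1 u1 M N \<xi> = 1"
proof -
  define d where "d = d1"
  define K where "K = real (Suc d) ^ 2 * 2 ^ (d * Suc d + 4 * d + 4)"
  have \<kappa>_small: "\<kappa> \<le> u1 / 8" "\<kappa> * real d \<le> u1 / 8"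
  proof -
    have "1 \<le> d1 * Suc d1" "d1 \<le> d1 * Suc d1" using d1 by auto
    then have "real 1 \<le> real (d1 * Suc d1)" "real d1 \<le> real (d1 * Suc d1)"
      by (simp_all only: of_nat_le_iff)
    then have "\<kappa> * 1 \<le> \<kappa> * real (d1 * Suc d1)" "\<kappa> * real d \<le> \<kappa> * real (d1 * Suc d1)"
      using \<kappa>(1) unfolding d_def by (intro mult_left_mono; simp only: of_nat_1 less_imp_le)+
    then show "\<kappa> \<le> u1 / 8" "\<kappa> * real d \<le> u1 / 8" using \<kappa>(2) by auto
  qed
  have K_ge: "real (Suc d) ^ 2 * 2 ^ k \<le> K" if "k \<le> d * Suc d + 4 * d + 4" for k
    unfolding K_def using that by (intro mult_left_mono power_increasing) auto
  have sq: "1 \<le> real (Suc d) ^ 2" "real (Suc d) \<le> real (Suc d) ^ 2"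
    by (intro one_le_power self_le_power; simp)+
  have K_ge2: "2 ^ k \<le> K" if "k \<le> d * Suc d + 4 * d + 4" for k
    using order.trans[OF mult_right_mono[OF sq(1)] K_ge[OF that]] by simp
  have K_ge3: "real (Suc d) * 2 ^ k \<le> K" if "k \<le> d * Suc d + 4 * d + 4" for k
    using order.trans[OF mult_right_mono[OF sq(2)] K_ge[OF that]] by simp
  have KM: "K \<le> M powr (u1 / 2)" using M(2) by (simp add: K_def d_def)
  have pmono: "M powr x \<le> M powr y" if "x \<le> y" for x y using M(1) that by (rule powr_mono[rotated])
  have "M powr (u1 / 2) \<le> M powr 1" using u1 by (intro pmono) auto
  then have KM1: "K \<le> M" using KM M(1) by simp
  have M2: "2 \<le> M" using K_ge2[of 1] KM1 by simp
  have Mpos: "0 < M" using M2 by simp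
  have powr_le_M: "M powr x \<le> M" if "x \<le> 1" for x using pmono[OF that] Mpos by simp
  have Npos: "1 \<le> N" using N one_le_power[OF M(1), of "100 * Suc d1"] by linarith
  have Npow: "N \<le> N ^ g" if "1 \<le> g" for g :: nat using Npos that power_increasing[of 1 g N] by simp

  \<comment> \<open>clustered nodes, which give small denominators\<close>
  define L where "L = nat \<lceil>M powr \<kappa>\<rceil>"
  have ge1: "1 \<le> M powr \<kappa>" using M(1) \<kappa>(1) by (simp add: ge_one_powr_ge_zero)
  have L: "M powr \<kappa> \<le> real L" "real L \<le> 2 * M powr \<kappa>" using ge1 unfolding L_def by linarith+
  have L1: "1 \<le> L" using L ge1 by linarith
  have LM: "real L \<le> M"
  proof -
    have "2 \<le> M powr (u1 / 2)" using K_ge2[of 1] KM by simp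
    then have "2 * M powr \<kappa> \<le> M powr (u1 / 2) * M powr \<kappa>" by (intro mult_right_mono) auto
    also have "\<dots> = M powr (u1 / 2 + \<kappa>)" by (simp add: powr_add)
    also have "\<dots> \<le> M" using \<kappa>_small u1 by (intro powr_le_M) auto
    finally show ?thesis using L(2) by linarith
  qed
  have M_1\<kappa>: "M powr (1 - \<kappa>) = M / M powr \<kappa>" using Mpos by (simp add: powr_diff)
  have "\<exists>T\<subseteq>S. card T = Suc d \<and> (\<forall>s\<in>T. \<forall>t\<in>T. \<bar>s - t\<bar> \<le> int L)"
  proof (rule clustered_subset[OF S L1 LM])
    have "3 * real d * M / real L \<le> 3 * real d * M / M powr \<kappa>"
      using L(1) L1 Mpos by (intro divide_left_mono mult_pos_pos) auto
    also have "\<dots> = 3 * real d * M powr (1 - \<kappa>)" by (simp add: M_1\<kappa>)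
    also have "\<dots> \<le> 6 * real (Suc d1) * M powr (1 - \<kappa>)"
      by (intro mult_right_mono) (auto simp: d_def)
    finally show "3 * real d * M / real L < real (card S)" using dense by simp
  qed
  then obtain TA where TA: "TA \<subseteq> S" "card TA = Suc d" "\<And>s t. s \<in> TA \<Longrightarrow> t \<in> TA \<Longrightarrow> \<bar>s - t\<bar> \<le> int L"
    by blast

  \<comment> \<open>separated nodes, which give the sharp error\<close>
  define b where "b = M powr (1 - \<kappa>)"
  have b1: "1 \<le> b" unfolding b_def using M(1) \<kappa>_small u1 by (intro ge_one_powr_ge_zero) auto
  define B where "B = nat \<lceil>b\<rceil>"
  have B: "b \<le> real B" "real B \<le> 2 * b" using b1 unfolding B_def by linarith+
  have "\<exists>T\<subseteq>S. card T = Suc d \<and> (\<forall>s\<in>T. \<forall>t\<in>T. s \<noteq> t \<longrightarrow> int B \<le> \<bar>s - t\<bar>)"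
  proof (rule separated_subset[OF S(1)])
    show "0 < B" using B b1 by linarith
    have "real d * real B \<le> real d * (2 * b)" using B by (intro mult_left_mono) auto
    also have "\<dots> \<le> 6 * real (Suc d1) * b" using b1 by (simp add: d_def)
    also have "\<dots> < real (card S)" using dense by (simp add: b_def)
    finally show "d * B < card S" by (metis of_nat_less_iff of_nat_mult)
  qed
  then obtain TB where TB: "TB \<subseteq> S" "card TB = Suc d"
    "\<And>s t. s \<in> TB \<Longrightarrow> t \<in> TB \<Longrightarrow> s \<noteq> t \<Longrightarrow> int B \<le> \<bar>s - t\<bar>"
    by blast

  obtain q where q: "1 \<le> q" "q \<le> 2 ^ lvl (M powr u2)" "\<And>g. g \<in> {1..d2} \<Longrightarrow> real q * \<theta> g \<in> \<int>"
    using Sigma_le_denominator[OF \<theta>] by metis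
  define Q where "Q = int q * nodal_disc TA"
  have Qnz: "Q \<noteq> 0" using q(1) TA(2) nodal_disc_nz[of TA] by (auto simp: Q_def card_ge_0_finite)
  \<comment> \<open>the factor 1/2 is the loss in passing from \<open>M powr u1\<close> to a power of 2 below it\<close>
  have Qbound: "\<bar>real_of_int Q\<bar> \<le> M powr u1 / 2"
  proof -
    have "real q \<le> 2 ^ lvl (M powr u2)" using q(2) by (metis of_nat_le_iff of_nat_numeral of_nat_power)
    also have "\<dots> \<le> M powr u2" using M(1) small by (intro lvl_bounds ge_one_powr_ge_zero) auto
    finally have 1: "real q \<le> M powr u2" .
    have "real_of_int \<bar>nodal_disc TA\<bar> \<le> real_of_int (int L ^ (d * Suc d))"
      using nodal_disc_bound[OF TA(2,3)] by (simp only: of_int_le_iff)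
    also have "\<dots> \<le> (2 * M powr \<kappa>) ^ (d * Suc d)" using L(2) by (simp only: of_int_power of_int_of_nat_eq) (intro power_mono; simp)
    also have "\<dots> = 2 ^ (d * Suc d) * M powr (\<kappa> * real (d * Suc d))"
      using Mpos by (simp only: power_mult_distrib powr_power mult.commute)
    also have "\<dots> \<le> 2 ^ (d * Suc d) * M powr (u1 / 8)"
      using \<kappa>(2) by (intro mult_left_mono pmono) (auto simp: d_def)
    finally have 2: "real_of_int \<bar>nodal_disc TA\<bar> \<le> 2 ^ (d * Suc d) * M powr (u1 / 8)" .
    have "\<bar>real_of_int Q\<bar> = real q * real_of_int \<bar>nodal_disc TA\<bar>" by (simp add: Q_def abs_mult)
    also have "\<dots> \<le> M powr (u1 / 8) * (2 ^ (d * Suc d) * M powr (u1 / 8))"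
      using order.trans[OF 1 pmono[OF small(2)]] 2 by (intro mult_mono) auto
    also have "\<dots> = 2 ^ Suc (d * Suc d) * M powr (u1 / 4) / 2" by (simp add: powr_add[symmetric])
    also have "\<dots> \<le> M powr (u1 / 2) * M powr (u1 / 4) / 2"
      using order.trans[OF K_ge2[of "Suc (d * Suc d)"] KM] by (intro divide_right_mono mult_right_mono) auto
    also have "\<dots> \<le> M powr u1 / 2" using u1 by (simp add: powr_add[symmetric] pmono)
    finally show ?thesis .
  qed
  have Q_le_M: "\<bar>real_of_int Q\<bar> \<le> M"
    using Qbound powr_le_M[of u1] u1 Mpos by (smt (verit) divide_nonneg_nonneg field_sum_of_halves powr_ge_zero)

  have approx: "\<exists>r. \<forall>i\<le>d. of_int Q * r i \<in> \<int> \<and>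
      \<bar>\<xi> (i, g) - r i\<bar> \<le> real (Suc d) * (2 ^ d * (2 * M) ^ (d - i) / b ^ d) * (M powr chi2 / N ^ g)"
    if g: "1 \<le> g" "g \<le> d2" for g
    unfolding Q_def
  proof (rule rational_coefficients[OF TA(2) TB(2)])
    fix t assume t: "t \<in> TA \<union> TB"
    then have tS: "t \<in> S" using TA(1) TB(1) by blast
    obtain k :: int where "torus_diff (frac (slice d1 \<xi> t g)) (\<theta> g) = frac (slice d1 \<xi> t g) - \<theta> g - of_int k"
      unfolding torus_diff_def using torus_rep_cong by metis
    then have "torus_diff (frac (slice d1 \<xi> t g)) (\<theta> g)
        = (\<Sum>j=0..d. \<xi> (j, g) * of_int t ^ j) - \<theta> g - of_int (k + \<lfloor>slice d1 \<xi> t g\<rfloor>)"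
      by (simp add: slice_def frac_def d_def)
    then show "\<exists>k::int. \<bar>(\<Sum>j=0..d. \<xi> (j, g) * of_int t ^ j) - \<theta> g - of_int k\<bar> \<le> M powr chi2 / N ^ g"
      using near[OF tS g] by metis
    show "\<bar>of_int t\<bar> \<le> 2 * M" using S(2)[OF tS] Mpos by auto
  next
    show "1 \<le> 2 * M" "0 < b" using M2 b1 by auto
    show "of_int (int q) * \<theta> g \<in> \<int>" using q(3) g by simp
    show "int q \<noteq> 0" using q(1) by simp
    show "b \<le> \<bar>of_int (s - t)\<bar>" if "s \<in> TB" "t \<in> TB" "s \<noteq> t" for s t
      using TB(3)[OF that] B(1) by linarith
    have \<epsilon>: "M powr chi2 / N ^ g \<le> M / N"
      using powr_le_M[of chi2] small u1 Npow[OF g(1)] Npos Mpos by (intro frac_le) auto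
    have "2 * real (Suc d) ^ 2 * 2 ^ d * (2 * M) ^ (2 * d) = (real (Suc d) ^ 2 * 2 ^ (3 * d + 1)) * M ^ (2 * d)"
    proof -
      have "(2::real) ^ (2 * d) = 2 ^ d * 2 ^ d" by (simp add: mult_2 power_add)
      then have "(2 * M) ^ (2 * d) = 2 ^ d * 2 ^ d * M ^ (2 * d)" by (simp only: power_mult_distrib)
      moreover have "(2::real) ^ (3 * d + 1) = 2 * (2 ^ d * 2 ^ d * 2 ^ d)"
      proof -
        have "3 * d + 1 = Suc (d + d + d)" by simp
        then show ?thesis by (simp only: power_Suc power_add)
      qed
      ultimately show ?thesis by (simp only: mult_ac)
    qed
    also have "\<dots> \<le> M * M ^ (2 * d)" using order.trans[OF K_ge[of "3 * d + 1"] KM1] Mpos by (intro mult_right_mono) auto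
    finally have base: "2 * real (Suc d) ^ 2 * 2 ^ d * (2 * M) ^ (2 * d) \<le> M * M ^ (2 * d)" .
    have "2 * real (Suc d) ^ 2 * 2 ^ d * (2 * M) ^ (2 * d) * (M powr chi2 / N ^ g) * \<bar>of_int Q\<bar>
        \<le> (M * M ^ (2 * d)) * (M / N) * M"
      by (rule mult_mono[OF mult_mono[OF base \<epsilon>] Q_le_M]) (use Npos Mpos in auto)
    also have "\<dots> = M ^ (2 * d + 3) / N" by (simp add: power_add power3_eq_cube)
    also have "\<dots> < 1"
    proof -
      have "M ^ (2 * d + 3) < M ^ (100 * Suc d1)" using M2 by (intro power_strict_increasing) (auto simp: d_def)
      then show ?thesis using N Npos by simp
    qed
    finally show "2 * real (Suc d) ^ 2 * 2 ^ d * (2 * M) ^ (2 * d) * (M powr chi2 / N ^ g)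
        * \<bar>of_int (int q * nodal_disc TA)\<bar> < 1"
      unfolding Q_def .
  qed
  have "\<exists>r. \<forall>g\<in>{1..d2}. \<forall>i\<le>d. of_int Q * r g i \<in> \<int> \<and>
      \<bar>\<xi> (i, g) - r g i\<bar> \<le> real (Suc d) * (2 ^ d * (2 * M) ^ (d - i) / b ^ d) * (M powr chi2 / N ^ g)"
    by (rule bchoice) (use approx in auto)
  then obtain r where r: "\<And>g i. g \<in> {1..d2} \<Longrightarrow> i \<le> d \<Longrightarrow> of_int Q * r g i \<in> \<int>"
    "\<And>g i. g \<in> {1..d2} \<Longrightarrow> i \<le> d \<Longrightarrow>
      \<bar>\<xi> (i, g) - r g i\<bar> \<le> real (Suc d) * (2 ^ d * (2 * M) ^ (d - i) / b ^ d) * (M powr chi2 / N ^ g)"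
    by blast
  define \<omega> where "\<omega> = (\<lambda>\<gamma>\<in>Idx2 d1 d2. torus_rep (r (snd \<gamma>) (fst \<gamma>)))"
  have \<omega>: "\<omega> (i, g) = torus_rep (r g i)" if "g \<in> {1..d2}" "i \<le> d" for i g
    using that by (simp add: \<omega>_def Idx2_def d_def)
  have \<omega>_Sigma: "\<omega> \<in> Sigma_le (Idx2 d1 d2) (lvl (M powr u1))"
  proof (rule mem_Sigma_le[where Q = "nat \<bar>Q\<bar>"])
    show "\<omega> \<in> torus (Idx2 d1 d2)"
      unfolding torus_def \<omega>_def using torus_rep_range by auto
    show "1 \<le> nat \<bar>Q\<bar>" using Qnz by simp
    have "M powr u1 < 2 * 2 ^ lvl (M powr u1)"
      using M(1) u1 by (intro lvl_bounds ge_one_powr_ge_zero) auto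
    then have "real (nat \<bar>Q\<bar>) \<le> real (2 ^ lvl (M powr u1))" using Qbound by simp
    then show "nat \<bar>Q\<bar> \<le> 2 ^ lvl (M powr u1)" by (simp only: of_nat_le_iff)
    fix \<gamma> assume "\<gamma> \<in> Idx2 d1 d2"
    then obtain i g where ig: "\<gamma> = (i, g)" "g \<in> {1..d2}" "i \<le> d" by (auto simp: Idx2_def d_def)
    obtain k :: int where k: "torus_rep (r g i) = r g i - of_int k" using torus_rep_cong by metis
    have "of_int Q * torus_rep (r g i) \<in> \<int>"
      unfolding k right_diff_distrib by (intro Ints_diff r(1) ig Ints_mult Ints_of_int)
    then have "of_int \<bar>Q\<bar> * torus_rep (r g i) \<in> \<int>" by (auto simp: abs_if)
    then show "real (nat \<bar>Q\<bar>) * \<omega> \<gamma> \<in> \<int>" using ig by (simp add: \<omega>)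
  qed
  show ?thesis
  proof (rule major_proj_eq_1[OF \<eta> Mpos _ \<omega>_Sigma])
    show "0 < N" using Npos by simp
  next
    fix i g :: nat assume ig: "i \<le> d1" "1 \<le> g" "g \<le> d2"
    then have ig': "g \<in> {1..d2}" "i \<le> d" by (auto simp: d_def)
    have Ng: "0 < N ^ g" using Npos by simp
    obtain k :: int where k: "torus_rep (r g i) = r g i - of_int k" using torus_rep_cong by metis
    have "\<bar>torus_diff (\<xi> (i, g)) (\<omega> (i, g))\<bar> \<le> \<bar>\<xi> (i, g) - r g i\<bar>"
      using abs_torus_rep_le[of "\<xi> (i, g) - torus_rep (r g i)" k] by (simp add: \<omega>[OF ig'] torus_diff_def k)
    also have "\<dots> \<le> real (Suc d) * (2 ^ d * (2 * M) ^ (d - i) / b ^ d) * (M powr chi2 / N ^ g)"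
      by (rule r(2)[OF ig'])
    also have "\<dots> \<le> real (Suc d) * (2 ^ d * (2 ^ d * (M ^ d / M ^ i)) / b ^ d) * (M powr chi2 / N ^ g)"
    proof -
      have "(2 * M) ^ (d - i) = 2 ^ (d - i) * (M ^ d / M ^ i)"
        using Mpos ig' by (simp add: power_mult_distrib power_diff)
      also have "\<dots> \<le> 2 ^ d * (M ^ d / M ^ i)" using Mpos by (intro mult_right_mono power_increasing) auto
      finally show ?thesis using b1 Ng by (intro mult_right_mono mult_left_mono divide_right_mono) auto
    qed
    also have "\<dots> = (real (Suc d) * 2 ^ (2 * d + 2)) * M powr (\<kappa> * real d + chi2) / (4 * (M ^ i * N ^ g))"
    proof -
      have bd: "b ^ d = M ^ d / M powr (\<kappa> * real d)"
        using Mpos by (simp add: b_def M_1\<kappa> power_divide powr_power mult.commute)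
      have "2 * d + 2 = Suc (Suc (d + d))" by simp
      then have four: "(2::real) ^ (2 * d + 2) = 4 * (2 ^ d * 2 ^ d)" by (simp only: power_Suc power_add)
      have "s * (y * (y * (A / I)) / (A / P)) * (c / n) = s * (4 * (y * y)) * (P * c) / (4 * (I * n))"
        if "0 < A" "0 < P" "0 < I" "0 < n" for s y A I P c n :: real
        using that by (simp add: field_simps)
      then show ?thesis unfolding bd four powr_add using Mpos Ng by simp
    qed
    also have "\<dots> \<le> M powr (u1 / 2) * M powr (u1 / 4) / (4 * (M ^ i * N ^ g))"
      using order.trans[OF K_ge3[of "2 * d + 2"] KM] \<kappa>_small small Mpos Ng
      by (intro divide_right_mono mult_mono pmono) auto
    also have "\<dots> \<le> M powr chi1 / (4 * (M ^ i * N ^ g))"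
      using u1 Mpos Ng by (intro divide_right_mono) (auto simp: powr_add[symmetric] intro!: pmono)
    finally show "\<bar>torus_diff (\<xi> (i, g)) (\<omega> (i, g))\<bar> \<le> 1 / (4 * (M ^ i * N ^ g / M powr chi1))"
      by simp
    have "(2 ^ lvl (M powr u1))\<^sup>2 \<le> M\<^sup>2"
      using lvl_bounds(1)[of "M powr u1"] powr_le_M[of u1] M(1) u1
      by (intro power_mono) (auto simp: ge_one_powr_ge_zero)
    then have four: "4 ^ lvl (M powr u1) \<le> M\<^sup>2"
      by (simp add: power2_eq_square flip: power_mult_distrib)
    have "2 * M powr chi1 * 4 ^ lvl (M powr u1) \<le> M * M * M\<^sup>2"
      using M2 powr_le_M[OF u1(3)] four by (intro mult_mono) auto
    also have "\<dots> = M ^ 4" by (simp add: power2_eq_square power4_eq_xxxx)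
    also have "\<dots> < M ^ (100 * Suc d1)" using M2 by (intro power_strict_increasing) auto
    also have "\<dots> \<le> N ^ g" using N Npow[OF ig(2)] by linarith
    also have "\<dots> \<le> M ^ i * N ^ g" using one_le_power[OF M(1), of i] Ng by simp
    finally have "2 * M powr chi1 * 4 ^ lvl (M powr u1) < M ^ i * N ^ g" .
    moreover have "0 < M ^ i * N ^ g" "0 < M powr chi1" using Mpos Ng by auto
    ultimately show "2 / (M ^ i * N ^ g / M powr chi1) < 1 / 4 ^ lvl (M powr u1)"
      by (simp add: field_simps)
  qed
qed

section \<open>Density of the exceptional integers\<close>

definition window :: "real \<Rightarrow> real \<Rightarrow> int set" where
  "window \<tau> M = {k::int. M < of_int k \<and> of_int k \<le> \<tau> * M}"

lemma window_eq: "window \<tau> M = {\<lfloor>M\<rfloor> + 1..\<lfloor>\<tau> * M\<rfloor>}"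
  unfolding window_def by (auto simp: le_floor_iff floor_less_iff) linarith+

lemma finite_window: "finite (window \<tau> M)"
  by (simp add: window_eq)

lemma card_window_ge: "(\<tau> - 1) * M - 1 \<le> real (card (window \<tau> M))"
proof -
  have "(\<tau> - 1) * M - 1 \<le> of_int (\<lfloor>\<tau> * M\<rfloor> - \<lfloor>M\<rfloor>)" by (simp add: algebra_simps) linarith
  also have "\<dots> \<le> real (card (window \<tau> M))" by (simp add: window_eq)
  finally show ?thesis .
qed

lemma average_eq_density:
  "(\<Sum>\<^sub>\<infinity>m\<in>UNIV. avg_weight \<tau> M m * indicator (A m) \<xi>) =
     real (card {m \<in> window \<tau> M. \<xi> \<in> A m}) / real (card (window \<tau> M))"
proof -
  have "(\<Sum>\<^sub>\<infinity>m\<in>UNIV. avg_weight \<tau> M m * indicator (A m) \<xi>) =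
      (\<Sum>\<^sub>\<infinity>m\<in>window \<tau> M. indicator (A m) \<xi> / real (card (window \<tau> M)))"
    by (rule infsum_cong_neutral) (auto simp: avg_weight_def window_def)
  also have "\<dots> = (\<Sum>m\<in>window \<tau> M. indicator (A m) \<xi>) / real (card (window \<tau> M))"
    by (simp add: finite_window sum_divide_distrib)
  also have "(\<Sum>m\<in>window \<tau> M. indicator (A m) \<xi>) = real (card {m \<in> window \<tau> M. \<xi> \<in> A m})"
    by (simp add: indicator_def finite_window sum.If_cases Int_def)
  finally show ?thesis .
qed

text \<open>The scale \<open>N\<close> that makes \<open>m\<close> exceptional may vary with \<open>m\<close>. Passing to a smaller \<open>N\<close> only weakens
  the closeness to \<open>\<theta>\<close>, so at the least scale that occurs all exceptional \<open>m\<close> satisfy the closeness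
  condition simultaneously, while the projection still differs from 1 because that scale belongs to
  some exceptional \<open>m\<close>. The inverse statement \<open>dense_forces_major_arc\<close> then excludes a large
  proportion of exceptional \<open>m\<close>. For bounded \<open>M\<close> the estimate holds by the choice of \<open>C\<close>.\<close>

lemma exceptional_count:
  fixes \<tau> \<kappa> u1 chi1 u2 chi2 \<rho> :: real and d1 d2 :: nat
  assumes \<tau>: "1 < \<tau>" "\<tau> \<le> 2" and \<eta>: "cutoff \<eta>" and d1: "1 \<le> d1"
    and u1: "0 < u1" "8 * u1 \<le> chi1" "chi1 \<le> 1"
    and small: "0 < u2" "u2 \<le> u1 / 8" "0 < chi2" "chi2 \<le> u1 / 8"
    and \<kappa>: "0 < \<kappa>" "\<kappa> * real (d1 * Suc d1) \<le> u1 / 8"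
    and \<rho>: "100 * real (Suc d1) \<le> 1 / \<rho>"
  shows "\<exists>C>0. \<forall>M\<in>geom \<tau>. \<forall>\<theta>\<in>Sigma_le {1..d2} (lvl (M powr u2)). \<forall>\<xi>.
     real (card {m \<in> window \<tau> M. \<xi> \<in> A_theta d1 d2 \<tau> \<eta> chi1 u1 chi2 \<rho> M m \<theta>})
       \<le> C * M powr (- \<kappa>) * real (card (window \<tau> M))"
proof -
  define K :: real where "K = real (Suc d1) ^ 2 * 2 ^ (d1 * Suc d1 + 4 * d1 + 4)"
  have K: "0 < K" by (simp add: K_def)
  \<comment> \<open>beyond \<open>M0\<close>, the constant \<open>K\<close> is at most \<open>M powr (u1 / 2)\<close> and the window has at least
    \<open>(\<tau> - 1) M / 2\<close> elements\<close>
  define M0 where "M0 = max (max 1 (2 / (\<tau> - 1))) (K powr (2 / u1))"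
  have M0: "1 \<le> M0" "2 / (\<tau> - 1) \<le> M0" "K powr (2 / u1) \<le> M0" by (auto simp: M0_def)
  define C where "C = M0 powr \<kappa> + 12 * real (Suc d1) / (\<tau> - 1)"
  have C: "M0 powr \<kappa> \<le> C" "12 * real (Suc d1) / (\<tau> - 1) \<le> C" using \<tau> by (auto simp: C_def)
  have "0 < M0 powr \<kappa>" using M0 by simp
  then have Cpos: "0 < C" using C by linarith
  have "real (card {m \<in> window \<tau> M. \<xi> \<in> A_theta d1 d2 \<tau> \<eta> chi1 u1 chi2 \<rho> M m \<theta>})
       \<le> C * M powr (- \<kappa>) * real (card (window \<tau> M))"
    if M: "M \<in> geom \<tau>" and \<theta>: "\<theta> \<in> Sigma_le {1..d2} (lvl (M powr u2))" for M \<theta> \<xi>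
  proof (cases "M \<le> M0")
    case True
    have M1: "1 \<le> M" using M \<tau> by (auto simp: geom_def one_le_power)
    have "1 = M powr \<kappa> * M powr (- \<kappa>)" using M1 by (simp add: powr_add[symmetric])
    also have "\<dots> \<le> C * M powr (- \<kappa>)"
      using C(1) powr_mono2[of \<kappa> M M0] \<kappa> M1 True by (intro mult_right_mono) auto
    finally have "1 * real (card (window \<tau> M)) \<le> C * M powr (- \<kappa>) * real (card (window \<tau> M))"
      by (rule mult_right_mono) simp
    moreover have "card {m \<in> window \<tau> M. \<xi> \<in> A_theta d1 d2 \<tau> \<eta> chi1 u1 chi2 \<rho> M m \<theta>} \<le> card (window \<tau> M)"
      by (rule card_mono[OF finite_window]) auto
    ultimately show ?thesis by linarith
  next
    case False
    then have M1: "1 \<le> M" and M2: "2 / (\<tau> - 1) \<le> M" and M3: "K powr (2 / u1) \<le> M"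
      using M0 by auto
    have KM: "K \<le> M powr (u1 / 2)"
    proof -
      have "K = (K powr (2 / u1)) powr (u1 / 2)" using K u1 by (simp add: powr_powr)
      also have "\<dots> \<le> M powr (u1 / 2)" using M3 u1 by (intro powr_mono2) auto
      finally show ?thesis .
    qed
    have "2 \<le> (\<tau> - 1) * M" using M2 \<tau> by (simp add: field_simps)
    then have window: "(\<tau> - 1) * M / 2 \<le> real (card (window \<tau> M))"
      using card_window_ge[of \<tau> M] by linarith
    define S where "S = {m \<in> window \<tau> M. \<xi> \<in> A_theta d1 d2 \<tau> \<eta> chi1 u1 chi2 \<rho> M m \<theta>}"
    show ?thesis
    proof (rule ccontr)
      assume "\<not> ?thesis"
      then have big: "C * M powr (- \<kappa>) * real (card (window \<tau> M)) < real (card S)" by (simp add: S_def)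
      have "6 * real (Suc d1) * M powr (1 - \<kappa>)
          = (12 * real (Suc d1) / (\<tau> - 1)) * M powr (- \<kappa>) * ((\<tau> - 1) * M / 2)"
      proof -
        have "M powr (1 - \<kappa>) = M * M powr (- \<kappa>)" using M1 by (simp add: powr_diff powr_minus divide_inverse)
        moreover have "\<tau> - 1 \<noteq> 0" using \<tau> by simp
        ultimately show ?thesis by (simp del: of_nat_Suc)
      qed
      also have "\<dots> \<le> C * M powr (- \<kappa>) * real (card (window \<tau> M))"
        using C(2) window \<tau> M1 Cpos by (intro mult_mono) auto
      finally have dense: "6 * real (Suc d1) * M powr (1 - \<kappa>) < real (card S)" using big by linarith
      define bad where "bad = (\<lambda>n m. M powr (1 / \<rho>) \<le> \<tau> ^ n \<and>
        \<xi> \<in> A_scale d1 d2 \<eta> chi1 u1 chi2 M (\<tau> ^ n) m \<theta>)"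
      have S_iff: "m \<in> S \<longleftrightarrow> m \<in> window \<tau> M \<and> (\<exists>n. bad n m)" for m
        by (auto simp: S_def A_theta_def geom_def bad_def)
      define n0 where "n0 = (LEAST n. \<exists>m\<in>S. bad n m)"
      have "0 \<le> 6 * real (Suc d1) * M powr (1 - \<kappa>)" by simp
      then have "0 < real (card S)" using dense by linarith
      then obtain m where "m \<in> S" by fastforce
      then have "\<exists>n. \<exists>m\<in>S. bad n m" using S_iff by blast
      then have "\<exists>m\<in>S. bad n0 m" unfolding n0_def by (rule LeastI_ex)
      then obtain m0 where m0: "m0 \<in> S" "bad n0 m0" by blast
      have least: "n0 \<le> n" if "m \<in> S" "bad n m" for m n
        unfolding n0_def using that by (intro Least_le) blast
      have "major_proj d1 d2 \<eta> chi1 u1 M (\<tau> ^ n0) \<xi> = 1"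
      proof (rule dense_forces_major_arc[OF \<eta> d1 u1 small \<kappa> M1 _ _ _ _ \<theta> _ dense])
        show "real (Suc d1) ^ 2 * 2 ^ (d1 * Suc d1 + 4 * d1 + 4) \<le> M powr (u1 / 2)" using KM by (simp add: K_def)
        have "M ^ (100 * Suc d1) = M powr real (100 * Suc d1)" using M1 by (subst powr_realpow) auto
        also have "\<dots> \<le> M powr (1 / \<rho>)" using \<rho> M1 by (intro powr_mono) auto
        also have "\<dots> \<le> \<tau> ^ n0" using m0 by (simp add: bad_def)
        finally show "M ^ (100 * Suc d1) \<le> \<tau> ^ n0" .
        show "finite S" by (simp add: S_def finite_window)
        show "M < of_int m \<and> of_int m \<le> 2 * M" if "m \<in> S" for m
        proof -
          have "M < of_int m" "of_int m \<le> \<tau> * M" using that by (auto simp: S_def window_def)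
          moreover have "\<tau> * M \<le> 2 * M" using \<tau> M1 by (intro mult_right_mono) auto
          ultimately show ?thesis by linarith
        qed
        fix m g assume m: "m \<in> S" and g: "1 \<le> g" "g \<le> d2"
        obtain n where n: "bad n m" using m S_iff by blast
        have \<tau>n: "0 < \<tau> ^ n" for n using \<tau> by simp
        have "(\<Prod>g\<in>{1..d2}. \<eta> (2 powi Log ((\<tau> ^ n) ^ g / M powr chi2)
            * torus_diff (frac (slice d1 \<xi> m g)) (\<theta> g))) \<noteq> 0"
          using n by (simp add: bad_def A_scale_def)
        then have "\<eta> (2 powi Log ((\<tau> ^ n) ^ g / M powr chi2)
            * torus_diff (frac (slice d1 \<xi> m g)) (\<theta> g)) \<noteq> 0"
          using g by (subst (asm) prod_zero_iff) auto
        then have "\<bar>torus_diff (frac (slice d1 \<xi> m g)) (\<theta> g)\<bar> \<le> 1 / ((\<tau> ^ n) ^ g / M powr chi2)"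
          using \<tau>n M1 by (intro cutoff_scaled_nz[OF \<eta>]) auto
        also have "\<dots> = M powr chi2 / (\<tau> ^ n) ^ g" by simp
        also have "\<dots> \<le> M powr chi2 / (\<tau> ^ n0) ^ g"
          using least[OF m n] \<tau> by (intro divide_left_mono power_mono power_increasing) auto
        finally show "\<bar>torus_diff (frac (slice d1 \<xi> m g)) (\<theta> g)\<bar> \<le> M powr chi2 / (\<tau> ^ n0) ^ g" .
      qed
      then show False using m0(2) by (simp add: bad_def A_scale_def)
    qed
  qed
  then show ?thesis by (intro exI[of _ C] conjI ballI allI Cpos)
qed

section \<open>Choice of the parameters\<close>

text \<open>The bound on \<open>\<delta> (d2 + 1)\<close> comes from the term \<open>1 / (4 d1 (d1 + 1) d2 (d2 + 1))\<close> of
  \<open>delta_weyl\<close>. It makes the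
  number of points \<open>\<theta>\<close>, about \<open>M powr (u2 (d2 + 1))\<close>, negligible against the gain
  \<open>M powr (- \<kappa>)\<close>.\<close>

lemma is_delta_bounds:
  assumes "is_delta d1 d2 \<tau> \<delta>" "1 \<le> d1" "1 \<le> d2"
  shows "0 < \<delta>" "\<delta> < 1" "\<delta> * real (Suc d2) \<le> 1/8"
proof -
  obtain t \<delta>G \<delta>V where w: "weyl_exponent d2 t" and g: "gauss_exponent d1 d2 \<delta>G"
    and v: "vdc_exponent d1 d2 \<tau> \<delta>V" and \<delta>: "\<delta> = min (delta_weyl d1 d2 t) (min \<delta>G \<delta>V)"
    using assms(1) unfolding is_delta_def by (elim exE conjE)
  note * = w[unfolded weyl_exponent_def, THEN conjunct1]
      g[unfolded gauss_exponent_def, THEN conjunct1]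
      g[unfolded gauss_exponent_def, THEN conjunct2, THEN conjunct1]
      v[unfolded vdc_exponent_def, THEN conjunct1]
  have pos: "0 < 4 * real (d1 * (d1 + 1)) * real (d2 * (d2 + 1))"
    using assms(2,3) by (simp del: of_nat_mult of_nat_add)
  then have "0 < delta_weyl d1 d2 t"
    using *(1) unfolding delta_weyl_def by (simp only: min_less_iff_conj zero_less_divide_1_iff) simp
  then show "0 < \<delta>" "\<delta> < 1" using * by (auto simp: \<delta>)
  have d1: "2 \<le> real (d1 * (d1 + 1))"
  proof -
    have "1 * 2 \<le> d1 * (d1 + 1)" using assms(2) by (intro mult_mono) auto
    then show ?thesis by (metis mult_1 of_nat_le_iff of_nat_numeral)
  qed
  have "\<delta> \<le> 1 / (4 * real (d1 * (d1 + 1)) * real (d2 * (d2 + 1)))" by (simp add: \<delta> delta_weyl_def)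
  also have "\<dots> \<le> 1 / (8 * real (Suc d2))"
  proof (rule divide_left_mono)
    have "(4 * 2) * (1 * real (Suc d2)) \<le> (4 * real (d1 * (d1 + 1))) * (real d2 * real (Suc d2))"
      using d1 assms(3) by (intro mult_mono) auto
    then show "8 * real (Suc d2) \<le> 4 * real (d1 * (d1 + 1)) * real (d2 * (d2 + 1))"
      by (simp add: algebra_simps)
    show "0 < 4 * real (d1 * (d1 + 1)) * real (d2 * (d2 + 1)) * (8 * real (Suc d2))"
      by (intro mult_pos_pos[OF pos]) simp
  qed simp
  finally show "\<delta> * real (Suc d2) \<le> 1/8" by (simp add: field_simps)
qed

lemma card_Idx: "real (card (Idx d1 d2)) + 1 = real (Suc d1) * real (Suc d2)"
proof -
  have "card (Idx d1 d2) = card ({0..d1} \<times> {0..d2}) - 1"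
    unfolding Idx_def by (subst card_Diff_singleton) auto
  then have "card (Idx d1 d2) + 1 = Suc d1 * Suc d2" by simp
  then show ?thesis by (metis of_nat_1 of_nat_add of_nat_mult)
qed

theorem lemma7p61:
  fixes d1 d2 :: nat
  assumes "d1 \<ge> 1" "d2 \<ge> 1"
  defines "G \<equiv> real (card (Idx d1 d2))"
  shows
    "\<exists>C_Gamma>0. \<forall>(\<tau>::real) (\<eta> :: real \<Rightarrow> real) (p0::nat) (\<delta>::real)
        (chi1::real) (u1::real) (chi2::real) (u2::real) (\<alpha>::real) (\<rho>::real).
      1 < \<tau> \<longrightarrow> \<tau> \<le> 2 \<longrightarrow> cutoff \<eta> \<longrightarrow> 2 < p0 \<longrightarrow> even p0 \<longrightarrow> is_delta d1 d2 \<tau> \<delta> \<longrightarrow>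
      0 < chi1 \<longrightarrow> 0 < u1 \<longrightarrow> 0 < chi2 \<longrightarrow> 0 < u2 \<longrightarrow> 0 < \<alpha> \<longrightarrow>
      1 / (10 ^ 6 * G * real p0) > chi1 \<longrightarrow>
      chi1 > 4 * (G + 1) * u1 \<longrightarrow>
      4 * (G + 1) * u1 > 10 ^ 3 / \<delta> * (G + 1) ^ 3 * chi2 \<longrightarrow>
      10 ^ 3 / \<delta> * (G + 1) ^ 3 * chi2 > 10 ^ 3 / \<delta> * (G + 1) ^ 3 * u2 \<longrightarrow>
      10 ^ 3 / \<delta> * (G + 1) ^ 3 * u2 > 10 ^ 6 / \<delta> ^ 2 * (G + 1) ^ 6 * \<alpha> \<longrightarrow>
      0 < \<rho> \<longrightarrow> \<rho> < 1 \<longrightarrow> 1 / \<rho> > 100 * (G + 1 + C_Gamma) \<longrightarrow>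
      (\<exists>C>0. \<forall>M1\<in>geom \<tau>. \<forall>\<theta>\<in>Sigma_le {1..d2} (lvl (M1 powr u2)). \<forall>\<xi>\<in>torus (Idx d1 d2).
         (\<Sum>\<^sub>\<infinity>m1\<in>UNIV. avg_weight \<tau> M1 m1
             * indicator (A_theta d1 d2 \<tau> \<eta> chi1 u1 chi2 \<rho> M1 m1 \<theta>) \<xi>)
           \<le> C * M1 powr (- u1 / (2 * (G + 1) ^ 2))) \<and>
      (\<exists>C>0. \<forall>M1\<in>geom \<tau>. \<forall>\<xi>\<in>torus (Idx d1 d2).
         (\<Sum>\<^sub>\<infinity>m1\<in>UNIV. avg_weight \<tau> M1 m1
             * indicator (A_all d1 d2 \<tau> \<eta> chi1 u1 chi2 u2 \<rho> M1 m1) \<xi>)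
           \<le> C * M1 powr (- 4 * \<alpha>))"
  \<comment> \<open>the requirement on \<open>C_Gamma\<close> is \<open>100 (d1 + 1) \<le> 1 / \<rho>\<close>, so that \<open>N \<ge> M1 ^ (100 (d1 + 1))\<close>\<close>
proof (rule exI[of _ 1], intro conjI allI impI)
  show "(0::real) < 1" by simp
next
  fix \<tau> :: real and \<eta> :: "real \<Rightarrow> real" and p0 :: nat and \<delta> chi1 u1 chi2 u2 \<alpha> \<rho> :: real
  assume \<tau>: "1 < \<tau>" "\<tau> \<le> 2" and \<eta>: "cutoff \<eta>" and p0: "2 < p0" and \<delta>: "is_delta d1 d2 \<tau> \<delta>"
    and pos: "0 < chi1" "0 < u1" "0 < chi2" "0 < u2" "0 < \<alpha>"
    and c1: "1 / (10 ^ 6 * G * real p0) > chi1" and c2: "chi1 > 4 * (G + 1) * u1"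
    and c3: "4 * (G + 1) * u1 > 10 ^ 3 / \<delta> * (G + 1) ^ 3 * chi2"
    and c4: "10 ^ 3 / \<delta> * (G + 1) ^ 3 * chi2 > 10 ^ 3 / \<delta> * (G + 1) ^ 3 * u2"
    and c5: "10 ^ 3 / \<delta> * (G + 1) ^ 3 * u2 > 10 ^ 6 / \<delta> ^ 2 * (G + 1) ^ 6 * \<alpha>"
    and \<rho>: "1 / \<rho> > 100 * (G + 1 + 1)"
  define H where "H = G + 1"
  define \<kappa> where "\<kappa> = u1 / (2 * H ^ 2)"
  have H_eq: "H = real (Suc d1) * real (Suc d2)" unfolding H_def G_def by (rule card_Idx)
  have "real (Suc d1) * 2 \<le> H" unfolding H_eq using assms by (intro mult_left_mono) auto
  then have H: "2 * real (Suc d1) \<le> H" "4 \<le> H" using assms by auto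
  note \<delta>b = is_delta_bounds[OF \<delta> assms(1,2)]
  have \<kappa>pos: "0 < \<kappa>" using pos H by (simp add: \<kappa>_def)
  have \<kappa>d: "\<kappa> * real (d1 * Suc d1) \<le> u1 / 8"
  proof -
    have "(2 * real (Suc d1)) ^ 2 \<le> H ^ 2" using H by (intro power_mono) auto
    moreover have "real (d1 * Suc d1) \<le> real (Suc d1) ^ 2" by (simp add: power2_eq_square algebra_simps)
    moreover have "(2 * real (Suc d1)) ^ 2 = 4 * real (Suc d1) ^ 2" by (simp only: power_mult_distrib) simp
    ultimately have "4 * real (d1 * Suc d1) \<le> H ^ 2" by linarith
    then have "u1 * (4 * real (d1 * Suc d1)) \<le> u1 * H ^ 2" using pos by (intro mult_left_mono) auto
    then show ?thesis unfolding \<kappa>_def using H by (simp add: field_simps)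
  qed
  have \<kappa>u1: "\<kappa> \<le> u1 / 8"
  proof -
    have "(4::real) ^ 2 \<le> H ^ 2" using H by (intro power_mono) auto
    then have "u1 * 4 \<le> u1 * H ^ 2" using pos by (intro mult_left_mono) auto
    then show ?thesis unfolding \<kappa>_def using H by (simp add: field_simps)
  qed
  have chi2: "chi2 < \<delta> * \<kappa> / 125"
  proof -
    have "H * (1000 * H ^ 2 * chi2) < H * (4 * \<delta> * u1)"
      using c3 \<delta>b(1) H by (simp add: H_def[symmetric] field_simps power3_eq_cube power2_eq_square)
    then have "1000 * H ^ 2 * chi2 < 4 * \<delta> * u1" using H by simp
    then show ?thesis unfolding \<kappa>_def using H by (simp add: field_simps)
  qed
  have u2: "u2 < chi2"
  proof -
    have "0 < 10 ^ 3 / \<delta> * H ^ 3" using \<delta>b(1) H by simp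
    then show ?thesis using c4 unfolding H_def[symmetric] by (rule mult_left_less_imp_less[OF _ less_imp_le, rotated])
  qed
  have \<alpha>: "4 * \<alpha> < u2"
  proof -
    have "H ^ 6 = H ^ 3 * H ^ 3" by (simp flip: power_add)
    then have "10 ^ 6 / \<delta> ^ 2 * H ^ 6 * \<alpha> = (10 ^ 3 / \<delta> * H ^ 3) * (10 ^ 3 / \<delta> * H ^ 3 * \<alpha>)"
      by (simp add: power2_eq_square)
    then have "(10 ^ 3 / \<delta> * H ^ 3) * (10 ^ 3 / \<delta> * H ^ 3 * \<alpha>) < (10 ^ 3 / \<delta> * H ^ 3) * u2"
      using c5 unfolding H_def[symmetric] by linarith
    moreover have P: "0 < 10 ^ 3 / \<delta> * H ^ 3" using \<delta>b(1) H by simp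
    ultimately have 1: "10 ^ 3 / \<delta> * H ^ 3 * \<alpha> < u2" by (metis mult_less_cancel_left_pos)
    have "4 * 1 \<le> 10 ^ 3 / \<delta> * H ^ 3"
      using \<delta>b(1,2) H by (intro mult_mono one_le_power) (auto simp: field_simps)
    then have "4 * 1 * \<alpha> \<le> 10 ^ 3 / \<delta> * H ^ 3 * \<alpha>" using pos by (intro mult_right_mono) auto
    then show ?thesis using 1 by simp
  qed
  have \<delta>\<kappa>: "\<delta> * \<kappa> \<le> \<kappa>" using \<delta>b \<kappa>pos by simp
  have chi1: "8 * u1 \<le> chi1" "chi1 \<le> 1"
  proof -
    have "8 * u1 \<le> 4 * H * u1" using H pos by (intro mult_right_mono) auto
    then show "8 * u1 \<le> chi1" using c2 by (simp add: H_def)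
    have "1 * 1 * 1 \<le> 10 ^ 6 * G * real p0" using H p0 by (intro mult_mono) (auto simp: H_def)
    then have "1 / (10 ^ 6 * G * real p0) \<le> 1" by simp
    then show "chi1 \<le> 1" using c1 by linarith
  qed
  have "100 * real (Suc d1) \<le> 1 / \<rho>" using \<rho> H by (simp add: H_def)
  then obtain C where C: "0 < C" and count: "\<And>M \<theta> \<xi>. M \<in> geom \<tau> \<Longrightarrow> \<theta> \<in> Sigma_le {1..d2} (lvl (M powr u2)) \<Longrightarrow>
     real (card {m \<in> window \<tau> M. \<xi> \<in> A_theta d1 d2 \<tau> \<eta> chi1 u1 chi2 \<rho> M m \<theta>})
       \<le> C * M powr (- \<kappa>) * real (card (window \<tau> M))"
    using exceptional_count[OF \<tau> \<eta> assms(1) pos(2) chi1 pos(4) _ pos(3) _ \<kappa>pos \<kappa>d, of \<rho> d2]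
      chi2 u2 \<delta>\<kappa> \<kappa>u1 \<kappa>pos by auto
  have to_average: "x / real (card (window \<tau> M)) \<le> y"
    if "x \<le> y * real (card (window \<tau> M))" "0 \<le> y" for x y M
    using that by (cases "card (window \<tau> M) = 0") (auto simp: field_simps)
  show "\<exists>C>0. \<forall>M1\<in>geom \<tau>. \<forall>\<theta>\<in>Sigma_le {1..d2} (lvl (M1 powr u2)). \<forall>\<xi>\<in>torus (Idx d1 d2).
         (\<Sum>\<^sub>\<infinity>m1\<in>UNIV. avg_weight \<tau> M1 m1
             * indicator (A_theta d1 d2 \<tau> \<eta> chi1 u1 chi2 \<rho> M1 m1 \<theta>) \<xi>)
           \<le> C * M1 powr (- u1 / (2 * (G + 1) ^ 2))"
    unfolding average_eq_density
  proof (intro exI[of _ C] conjI ballI to_average)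
    fix M \<theta> \<xi> assume "M \<in> geom \<tau>" "\<theta> \<in> Sigma_le {1..d2} (lvl (M powr u2))"
    from count[OF this, of \<xi>]
    show "real (card {m \<in> window \<tau> M. \<xi> \<in> A_theta d1 d2 \<tau> \<eta> chi1 u1 chi2 \<rho> M m \<theta>})
       \<le> C * M powr (- u1 / (2 * (G + 1) ^ 2)) * real (card (window \<tau> M))"
      by (simp add: \<kappa>_def H_def)
  qed (use C in auto)
  show "\<exists>C>0. \<forall>M1\<in>geom \<tau>. \<forall>\<xi>\<in>torus (Idx d1 d2).
         (\<Sum>\<^sub>\<infinity>m1\<in>UNIV. avg_weight \<tau> M1 m1
             * indicator (A_all d1 d2 \<tau> \<eta> chi1 u1 chi2 u2 \<rho> M1 m1) \<xi>)
           \<le> C * M1 powr (- 4 * \<alpha>)"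
    unfolding average_eq_density
  proof (intro exI[of _ "3 ^ d2 * C"] conjI ballI to_average)
    fix M \<xi> assume M: "M \<in> geom \<tau>"
    have M1: "1 \<le> M" using M \<tau> by (auto simp: geom_def one_le_power)
    define \<Theta> where "\<Theta> = Sigma_le {1..d2} (lvl (M powr u2))"
    define W where "W = real (card (window \<tau> M))"
    have fin\<Theta>: "finite \<Theta>" unfolding \<Theta>_def by (rule Sigma_le_card) simp
    have card\<Theta>: "real (card \<Theta>) \<le> 3 ^ d2 * M powr (u2 * real (Suc d2))"
    proof -
      define l where "l = lvl (M powr u2)"
      have "card \<Theta> \<le> 2 ^ l * (3 * 2 ^ l) ^ card {1..d2}"
        unfolding \<Theta>_def l_def by (rule Sigma_le_card) simp
      then have "real (card \<Theta>) \<le> real (2 ^ l * (3 * 2 ^ l) ^ card {1..d2})" by (simp only: of_nat_le_iff)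
      also have "\<dots> = 3 ^ d2 * (2 ^ l) ^ Suc d2" by (simp add: power_mult_distrib)
      also have "\<dots> \<le> 3 ^ d2 * (M powr u2) ^ Suc d2"
        using M1 pos unfolding l_def
        by (intro mult_left_mono power_mono lvl_bounds ge_one_powr_ge_zero) auto
      also have "(M powr u2) ^ Suc d2 = M powr (u2 * real (Suc d2))"
        using M1 by (subst powr_power) (auto simp: mult.commute)
      finally show ?thesis .
    qed
    \<comment> \<open>union bound over \<open>\<theta>\<close>\<close>
    have "{m \<in> window \<tau> M. \<xi> \<in> A_all d1 d2 \<tau> \<eta> chi1 u1 chi2 u2 \<rho> M m}
        = (\<Union>\<theta>\<in>\<Theta>. {m \<in> window \<tau> M. \<xi> \<in> A_theta d1 d2 \<tau> \<eta> chi1 u1 chi2 \<rho> M m \<theta>})"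
      by (auto simp: A_all_def \<Theta>_def)
    then have "card {m \<in> window \<tau> M. \<xi> \<in> A_all d1 d2 \<tau> \<eta> chi1 u1 chi2 u2 \<rho> M m}
        \<le> (\<Sum>\<theta>\<in>\<Theta>. card {m \<in> window \<tau> M. \<xi> \<in> A_theta d1 d2 \<tau> \<eta> chi1 u1 chi2 \<rho> M m \<theta>})"
      by (simp only: card_UN_le[OF fin\<Theta>])
    then have "real (card {m \<in> window \<tau> M. \<xi> \<in> A_all d1 d2 \<tau> \<eta> chi1 u1 chi2 u2 \<rho> M m})
        \<le> (\<Sum>\<theta>\<in>\<Theta>. real (card {m \<in> window \<tau> M. \<xi> \<in> A_theta d1 d2 \<tau> \<eta> chi1 u1 chi2 \<rho> M m \<theta>}))"
      by (simp only: of_nat_le_iff flip: of_nat_sum)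
    also have "\<dots> \<le> (\<Sum>\<theta>\<in>\<Theta>. C * M powr (- \<kappa>) * W)"
      unfolding \<Theta>_def W_def by (intro sum_mono count M)
    also have "\<dots> = real (card \<Theta>) * (C * M powr (- \<kappa>) * W)" by simp
    also have "\<dots> \<le> (3 ^ d2 * M powr (u2 * real (Suc d2))) * (C * M powr (- \<kappa>) * W)"
      using card\<Theta> C by (intro mult_right_mono) (auto simp: W_def)
    also have "\<dots> = 3 ^ d2 * C * M powr (u2 * real (Suc d2) - \<kappa>) * W"
    proof -
      have "M powr (u2 * real (Suc d2) - \<kappa>) = M powr (u2 * real (Suc d2)) * M powr (- \<kappa>)"
        by (simp only: powr_add[symmetric]) simp
      then show ?thesis by (simp only: mult_ac)
    qed
    also have "\<dots> \<le> 3 ^ d2 * C * M powr (- 4 * \<alpha>) * W"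
    proof -
      have "u2 * real (Suc d2) \<le> (\<delta> * \<kappa> / 125) * real (Suc d2)" using u2 chi2 by (intro mult_right_mono) auto
      also have "\<dots> = (\<delta> * real (Suc d2)) * \<kappa> / 125" by simp
      also have "\<dots> \<le> 1/8 * \<kappa> / 125" using \<delta>b(3) \<kappa>pos by (intro divide_right_mono mult_right_mono) auto
      finally have "u2 * real (Suc d2) - \<kappa> \<le> - 4 * \<alpha>" using \<alpha> u2 chi2 \<delta>\<kappa> \<kappa>pos by linarith
      then show ?thesis using M1 C by (intro mult_right_mono mult_left_mono powr_mono) (auto simp: W_def)
    qed
    finally show "real (card {m \<in> window \<tau> M. \<xi> \<in> A_all d1 d2 \<tau> \<eta> chi1 u1 chi2 u2 \<rho> M m})
        \<le> 3 ^ d2 * C * M powr (- 4 * \<alpha>) * real (card (window \<tau> M))" unfolding W_def .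
  qed (use C in auto)
qed

end
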